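(* Consider the problem of minimizing $f(x)=\mathbb{E}[F(x;\omega)]$ over $x\in\mathcal{X}$, and suppose that it is variationally coherent. Suppose also that: (i) $F(x;\omega)$ is continuously differentiable in $x$ for almost all $\omega\in\Omega$; (ii) there is a finite $V\ge 0$ with $\mathbb{E}[\|\nabla F(x;\omega)\|_*^2]\le V^2$ for all $x\in\mathcal{X}$; (iii) for every $p\in\mathcal{X}$ and every sequence $y_n\in\mathcal{Y}$, $\Phi(p,y_n)\to 0$ whenever $Q(y_n)\to p$. Then the sequence of iterates $X_n$ of stochastic mirror descent converges with probability $1$ to a (possibly random) minimum point of $f$ over $\mathcal{X}$.
   Context: $\mathcal{X}$ is a nonempty compact convex subset of a finite-dimensional real vector space $\mathcal{V}$ with norm $\|\cdot\|$; $\mathcal{Y}=\mathcal{V}^*$ is the dual space, $\langle y,x\rangle$ the duality pairing, and $\|y\|_*=\sup\{\langle y,x\rangle:\|x\|\le 1\}$ the dual norm. $(\Omega,\mathcal{F},\mathbb{P})$ is a complete probability space, $F:\mathcal{X}\times\Omega\to\mathbb{R}$ is a stochastic objective, $f(x)=\mathbb{E}[F(x;\omega)]$, and $\mathcal{X}^*=\arg\min_{\mathcal{X}} f$. Gradients are taken with respect to $x$ and are elements of $\mathcal{Y}$. Under hypotheses (i) and (ii), $f$ is continuously differentiable with $\nabla f(x)=\mathbb{E}[\nabla F(x;\omega)]$. Variational coherence: the problem is variationally coherent if $\langle\nabla f(x),x-x^*\rangle\ge 0$ for all $x\in\mathcal{X}$, $x^*\in\mathcal{X}^*$, and there exists some $x^*\in\mathcal{X}^*$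 for which equality holds only if $x\in\mathcal{X}^*$. Mirror map: $h:\mathcal{X}\to\mathbb{R}$ is a regularizer, i.e. continuous and $K$-strongly convex for some $K>0$: $h(\tau x+(1-\tau)x')\le\tau h(x)+(1-\tau)h(x')-\tfrac12K\tau(1-\tau)\|x'-x\|^2$ for all $x,x'\in\mathcal{X}$, $\tau\in[0,1]$. The induced mirror map is $Q:\mathcal{Y}\to\mathcal{X}$, $Q(y)=\arg\max_{x\in\mathcal{X}}\{\langle y,x\rangle-h(x)\}$. The Fenchel coupling is $\Phi(p,y)=h(p)+h^*(y)-\langle y,p\rangle$ for $p\in\mathcal{X}$, $y\in\mathcal{Y}$, where $h^*(y)=\max_{x\in\mathcal{X}}\{\langle y,x\rangle-h(x)\}$. Stochastic mirror descent (SMD): $X_n=Q(Y_n)$, $Y_{n+1}=Y_n-\gamma_n\nabla F(X_n;\omega_n)$, $n=1,2,\dots$, with arbitrary deterministic initialization $Y_1\in\mathcal{Y}$, $\omega_n$ i.i.d. samples distributed according to $\mathbb{P}$, and step-sizes $\gamma_n>0$ satisfying $\sum_n\gamma_n^2<\infty$ and $\sum_n\gamma_n=\infty$. *)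

theory Defs
  imports "HOL-Probability.Probability"
begin

text \<open>
  The space \<open>V\<close> is a type \<open>'v\<close> of class \<open>real_normed_vector\<close>, with its own norm. Its
  (topological) dual is \<open>'v \<Rightarrow>\<^sub>L real\<close>, and the dual norm is the \<open>norm\<close> of that type. The class
  does not force finite dimension, so this is a separate predicate.
\<close>

definition finite_dimensional :: "'v::real_vector itself \<Rightarrow> bool" where
  "finite_dimensional _ \<longleftrightarrow> (\<exists>B::'v set. finite B \<and> span B = UNIV)"

text \<open>
  The feasible set may have empty interior, and functions matter only on it, so derivatives are taken
  within \<open>X\<close>. There, on a convex \<open>X\<close>, they determine the gradient up to
  functionals that vanish on all differences of points of \<open>X\<close>; hence the gradient map \<open>g\<close> is
  an argument.
\<close>

definition C1_on :: "'v::real_normed_vector set \<Rightarrow> ('v \<Rightarrow> real) \<Rightarrow> ('v \<Rightarrow> 'v \<Rightarrow>\<^sub>L real) \<Rightarrow> bool" where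
  "C1_on X \<phi> g \<longleftrightarrow>
     (\<forall>x\<in>X. (\<phi> has_derivative blinfun_apply (g x)) (at x within X)) \<and> continuous_on X g"

definition objective :: "'w measure \<Rightarrow> ('v \<Rightarrow> 'w \<Rightarrow> real) \<Rightarrow> 'v \<Rightarrow> real" where
  "objective M F x = (\<integral>\<omega>. F x \<omega> \<partial>M)"

definition minimizers :: "'v set \<Rightarrow> ('v \<Rightarrow> real) \<Rightarrow> 'v set" where
  "minimizers X f = {x. is_arg_min f (\<lambda>x. x \<in> X) x}"

text \<open>
  If \<open>f\<close> is differentiable within a convex \<open>X\<close>, the values of the following functional on differences of
  points of \<open>X\<close>, the only ones used below, do not depend on the choice inside \<open>frechet_derivative\<close>.
\<close>

definition gradient_on :: "'v::real_normed_vector set \<Rightarrow> ('v \<Rightarrow> real) \<Rightarrow> 'v \<Rightarrow> 'v \<Rightarrow>\<^sub>L real" where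
  "gradient_on X f x = Blinfun (frechet_derivative f (at x within X))"

definition variationally_coherent :: "'v::real_normed_vector set \<Rightarrow> ('v \<Rightarrow> real) \<Rightarrow> bool" where
  "variationally_coherent X f \<longleftrightarrow>
     (\<forall>x\<in>X. \<forall>p\<in>minimizers X f. blinfun_apply (gradient_on X f x) (x - p) \<ge> 0) \<and>
     (\<exists>p\<in>minimizers X f. \<forall>x\<in>X.
        blinfun_apply (gradient_on X f x) (x - p) = 0 \<longrightarrow> x \<in> minimizers X f)"

definition strongly_convex_on :: "'v::real_normed_vector set \<Rightarrow> real \<Rightarrow> ('v \<Rightarrow> real) \<Rightarrow> bool" where
  "strongly_convex_on X K h \<longleftrightarrow>
     (\<forall>x\<in>X. \<forall>x'\<in>X. \<forall>\<tau>\<in>{0..1}.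
        h (\<tau> *\<^sub>R x + (1 - \<tau>) *\<^sub>R x')
          \<le> \<tau> * h x + (1 - \<tau>) * h x' - 1/2 * K * \<tau> * (1 - \<tau>) * (norm (x' - x))\<^sup>2)"

definition regularizer :: "'v::real_normed_vector set \<Rightarrow> ('v \<Rightarrow> real) \<Rightarrow> bool" where
  "regularizer X h \<longleftrightarrow> continuous_on X h \<and> (\<exists>K>0. strongly_convex_on X K h)"

definition mirror_map ::
    "'v::real_normed_vector set \<Rightarrow> ('v \<Rightarrow> real) \<Rightarrow> ('v \<Rightarrow>\<^sub>L real) \<Rightarrow> 'v" where
  "mirror_map X h y = arg_max (\<lambda>x. blinfun_apply y x - h x) (\<lambda>x. x \<in> X)"

definition convex_conjugate ::
    "'v::real_normed_vector set \<Rightarrow> ('v \<Rightarrow> real) \<Rightarrow> ('v \<Rightarrow>\<^sub>L real) \<Rightarrow> real" where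
  "convex_conjugate X h y = (SUP x\<in>X. blinfun_apply y x - h x)"

definition fenchel_coupling ::
    "'v::real_normed_vector set \<Rightarrow> ('v \<Rightarrow> real) \<Rightarrow> 'v \<Rightarrow> ('v \<Rightarrow>\<^sub>L real) \<Rightarrow> real" where
  "fenchel_coupling X h p y = h p + convex_conjugate X h y - blinfun_apply y p"

text \<open>
  Dual iterates \<open>Y\<close> of stochastic mirror descent along one sample sequence \<open>w\<close>, indexed from 0;
  \<open>DF x \<omega>\<close> stands for the gradient of \<open>F(\<cdot>; \<omega>)\<close> at \<open>x\<close>.
\<close>

primrec smd_dual ::
    "'v::real_normed_vector set \<Rightarrow> ('v \<Rightarrow> real) \<Rightarrow> ('v \<Rightarrow> 'w \<Rightarrow> 'v \<Rightarrow>\<^sub>L real) \<Rightarrow>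
     (nat \<Rightarrow> real) \<Rightarrow> ('v \<Rightarrow>\<^sub>L real) \<Rightarrow> (nat \<Rightarrow> 'w) \<Rightarrow> nat \<Rightarrow> 'v \<Rightarrow>\<^sub>L real" where
  "smd_dual X h DF \<gamma> y w 0 = y"
| "smd_dual X h DF \<gamma> y w (Suc n) =
     smd_dual X h DF \<gamma> y w n
       - \<gamma> n *\<^sub>R DF (mirror_map X h (smd_dual X h DF \<gamma> y w n)) (w n)"

definition smd ::
    "'v::real_normed_vector set \<Rightarrow> ('v \<Rightarrow> real) \<Rightarrow> ('v \<Rightarrow> 'w \<Rightarrow> 'v \<Rightarrow>\<^sub>L real) \<Rightarrow>
     (nat \<Rightarrow> real) \<Rightarrow> ('v \<Rightarrow>\<^sub>L real) \<Rightarrow> (nat \<Rightarrow> 'w) \<Rightarrow> nat \<Rightarrow> 'v" where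
  "smd X h DF \<gamma> y w n = mirror_map X h (smd_dual X h DF \<gamma> y w n)"

text \<open>
  The samples live on an arbitrary probability space \<open>N\<close>, which need not be the space \<open>M\<close>
  of the random objective.
\<close>

definition iid_samples :: "'s measure \<Rightarrow> 'w measure \<Rightarrow> (nat \<Rightarrow> 's \<Rightarrow> 'w) \<Rightarrow> bool" where
  "iid_samples N M W \<longleftrightarrow>
     prob_space N \<and> prob_space.indep_vars N (\<lambda>_. M) W UNIV \<and> (\<forall>n. distr N M (W n) = M)"

end

theory Submission
  imports Defs
begin

text \<open>
  For a minimizer \<open>p\<close>, strong convexity of \<open>h\<close> gives
  \<open>\<Phi> p (Y (n+1)) \<le> \<Phi> p (Y n) - \<gamma> n * \<langle>\<nabla>f (X n), X n - p\<rangle> - \<gamma> n * \<xi> n + (\<gamma> n)\<^sup>2 * \<beta> n\<close>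
  with a martingale difference \<open>\<xi>\<close> and \<open>\<beta>\<close> a multiple of the squared gradient norm. The noise series converges
  almost surely by Kolmogorov's inequality and the series of squares by monotone convergence. Since the drift is
  nonnegative by coherence, \<open>\<Phi> p (Y n)\<close> converges and \<open>\<Sum>n. \<gamma> n * \<langle>\<nabla>f (X n), X n - p\<rangle>\<close> is finite. As
  \<open>\<Sum>n. \<gamma> n\<close> diverges, for the distinguished \<open>p\<close> some limit point \<open>q\<close> of the iterates satisfies
  \<open>\<langle>\<nabla>f q, q - p\<rangle> = 0\<close>, hence is a minimizer. Along that subsequence \<open>\<Phi> q (Y n)\<close> tends to \<open>0\<close> by hypothesis (iii);
  as \<open>\<Phi> q (Y n)\<close> converges, it tends to \<open>0\<close>, and so does \<open>norm (X n - q)\<close>.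
\<close>

section \<open>Measurability, uniform integrability and almost decreasing sequences\<close>

text \<open>Compactness gives finite nets of every mesh \<open>1 / real (Suc n)\<close>, and their
  countable union is dense. It reduces measurability questions on \<open>X\<close> to countably many
  points.\<close>

lemma compact_countable_dense:
  fixes X :: "'a::metric_space set"
  assumes "compact X" "X \<noteq> {}"
  obtains d :: "nat \<Rightarrow> 'a" where "range d \<subseteq> X" "\<And>x e. x \<in> X \<Longrightarrow> e > 0 \<Longrightarrow> \<exists>i. dist x (d i) < e"
proof -
  have "\<forall>e>0. \<exists>k. finite k \<and> k \<subseteq> X \<and> X \<subseteq> (\<Union>x\<in>k. ball x e)"
    using assms(1) compact_eq_totally_bounded by (metis compact_imp_seq_compact seq_compact_imp_totally_bounded)
  then have "\<forall>n::nat. \<exists>k. finite k \<and> k \<subseteq> X \<and> X \<subseteq> (\<Union>x\<in>k. ball x (1 / real (Suc n)))"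
    by simp
  then obtain k where k: "\<And>n. finite (k n)" "\<And>n. k n \<subseteq> X"
      "\<And>n. X \<subseteq> (\<Union>x\<in>k n. ball x (1 / real (Suc n)))"
    by metis
  let ?D = "\<Union>n. k n"
  have ne: "?D \<noteq> {}" using k(3)[of 0] assms(2) by auto
  have ct: "countable ?D" using k(1) by (auto intro: countable_finite)
  show thesis
  proof
    show "range (from_nat_into ?D) \<subseteq> X"
      unfolding range_from_nat_into[OF ne ct] using k(2) by blast
    fix y and e :: real assume y: "y \<in> X" "e > 0"
    obtain n where n: "1 / real (Suc n) < e" using y(2) nat_approx_posE by blast
    obtain z where z: "z \<in> k n" "dist z y < 1 / real (Suc n)" using k(3)[of n] y(1) by auto
    have "z \<in> range (from_nat_into ?D)" unfolding range_from_nat_into[OF ne ct] using z(1) by blast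
    then obtain i where "z = from_nat_into ?D i" by blast
    then have "dist y (from_nat_into ?D i) < e"
      using z n by (simp add: dist_commute)
    then show "\<exists>i. dist y (from_nat_into ?D i) < e" ..
  qed
qed

text \<open>Caratheodory functions are approximated by replacing \<open>Z s\<close> with the first point of a
  countable dense sequence that is sufficiently close.\<close>

lemma borel_measurable_Caratheodory:
  fixes G :: "'v::metric_space \<Rightarrow> 'w \<Rightarrow> real"
  assumes "compact X" and Z[measurable]: "Z \<in> borel_measurable S" and ZX: "\<And>s. s \<in> space S \<Longrightarrow> Z s \<in> X"
    and w[measurable]: "w \<in> measurable S M"
    and G: "\<And>x. x \<in> X \<Longrightarrow> G x \<in> borel_measurable M"
    and cont: "\<And>z. z \<in> space M \<Longrightarrow> continuous_on X (\<lambda>x. G x z)"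
  shows "(\<lambda>s. G (Z s) (w s)) \<in> borel_measurable S"
proof (cases "X = {}")
  case True
  then have "space S = {}" using ZX by auto
  then show ?thesis by (simp add: measurable_def)
next
  case False
  obtain d :: "nat \<Rightarrow> 'v" where d: "range d \<subseteq> X" "\<And>x e. x \<in> X \<Longrightarrow> e > 0 \<Longrightarrow> \<exists>i. dist x (d i) < e"
    using compact_countable_dense[OF assms(1) False] by metis
  have dist[measurable]: "(\<lambda>s. dist (Z s) (d i)) \<in> borel_measurable S" for i
    by (rule measurable_compose[OF Z]) (intro borel_measurable_continuous_onI continuous_intros)
  define r where "r n s = (LEAST i. dist (Z s) (d i) < 1 / real (Suc n))" for n s
  have r[measurable]: "r n \<in> measurable S (count_space UNIV)" for n
    unfolding r_def by measurable
  have rd: "dist (Z s) (d (r n s)) < 1 / real (Suc n)" if "s \<in> space S" for s n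
    unfolding r_def by (rule LeastI_ex[OF d(2)[OF ZX[OF that]]]) simp
  \<comment> \<open>The index \<open>r n s\<close> ranges over a countable set, so measurability of
    each section \<open>G (d i)\<close> suffices.\<close>
  have "(\<lambda>s. G (d (r n s)) (w s)) \<in> borel_measurable S" for n
  proof (rule measurable_compose_countable[OF _ r])
    fix i show "(\<lambda>s. G (d i) (w s)) \<in> borel_measurable S"
      by (rule measurable_compose[OF w G]) (use d(1) in auto)
  qed
  moreover have "(\<lambda>n. G (d (r n s)) (w s)) \<longlonglongrightarrow> G (Z s) (w s)" if s: "s \<in> space S" for s
  proof -
    have "(\<lambda>n. dist (d (r n s)) (Z s)) \<longlonglongrightarrow> 0"
    proof (rule real_tendsto_sandwich[OF _ _ tendsto_const lim_1_over_n[THEN LIMSEQ_Suc]])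
      show "\<forall>\<^sub>F n in sequentially. dist (d (r n s)) (Z s) \<le> 1 / of_nat (Suc n)"
        using rd[OF s] by (auto simp: dist_commute less_imp_le intro!: always_eventually)
    qed auto
    then have "(\<lambda>n. d (r n s)) \<longlonglongrightarrow> Z s" by (rule tendsto_dist_iff[THEN iffD2])
    moreover have "d (r n s) \<in> X" for n using d(1) by auto
    ultimately show ?thesis
      by (intro continuous_on_tendsto_compose[OF cont[OF measurable_space[OF w s]] _ ZX[OF s]])
         (simp_all add: always_eventually)
  qed
  ultimately show ?thesis by (rule borel_measurable_LIMSEQ_real[rotated])
qed

lemma (in prob_space) integrable_of_second_moment:
  fixes u :: "'a \<Rightarrow> real"
  assumes [measurable]: "u \<in> borel_measurable M" and C: "(\<integral>\<^sup>+x. ennreal ((u x)\<^sup>2) \<partial>M) \<le> ennreal C"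
  shows "integrable M (\<lambda>x. (u x)\<^sup>2)" "integrable M u"
proof -
  show i: "integrable M (\<lambda>x. (u x)\<^sup>2)"
    using C by (intro integrableI_nonneg) (auto intro: le_less_trans)
  show "integrable M u"
    by (rule square_integrable_imp_integrable) (use i in auto)
qed

text \<open>A bound on second moments gives uniform integrability, through
  \<open>\<bar>u\<bar> \<le> min \<bar>u\<bar> L + u\<^sup>2 / L\<close>.\<close>

lemma (in prob_space) tendsto_expectation_zero:
  fixes u :: "nat \<Rightarrow> 'a \<Rightarrow> real"
  assumes u[measurable]: "\<And>k. u k \<in> borel_measurable M"
    and lim: "AE x in M. (\<lambda>k. u k x) \<longlonglongrightarrow> 0"
    and C: "\<And>k. (\<integral>\<^sup>+x. ennreal ((u k x)\<^sup>2) \<partial>M) \<le> ennreal C"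
  shows "(\<lambda>k. \<integral>x. \<bar>u k x\<bar> \<partial>M) \<longlonglongrightarrow> 0"
proof -
  \<comment> \<open>\<open>ennreal\<close> sends a negative \<open>C\<close> to \<open>0\<close>;
    \<open>C'\<close> is the corresponding real bound.\<close>
  define C' where "C' = max C 0"
  note int = integrable_of_second_moment[OF u C]
  have C': "(\<integral>x. (u k x)\<^sup>2 \<partial>M) \<le> C'" for k
    using C[of k] unfolding C'_def
    by (subst integral_eq_nn_integral) (auto simp: ennreal_max_0 intro!: enn2real_leI)
  show ?thesis
  proof (rule LIMSEQ_I)
    fix e :: real assume e: "e > 0"
    \<comment> \<open>This truncation level makes \<open>C' / L\<close> at most
      \<open>e / 2\<close>; the summand \<open>1\<close> keeps it positive when
      \<open>C' = 0\<close>.\<close>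
    define L where "L = 2 * C' / e + 1"
    have L: "L > 0" unfolding L_def C'_def using e by (auto intro!: add_nonneg_pos)
    have "C' / L \<le> e / 2"
      using e L by (simp add: divide_le_eq L_def field_simps)
    have lim2: "(\<lambda>k. \<integral>x. min \<bar>u k x\<bar> L \<partial>M) \<longlonglongrightarrow> (\<integral>x. 0 \<partial>M)"
    proof (rule integral_dominated_convergence[where w="\<lambda>_. L"])
      show "AE x in M. (\<lambda>k. min \<bar>u k x\<bar> L) \<longlonglongrightarrow> 0"
        using lim
      proof eventually_elim
        case (elim x)
        have "(\<lambda>k. min \<bar>u k x\<bar> L) \<longlonglongrightarrow> min \<bar>0\<bar> L"
          by (intro tendsto_intros elim)
        then show ?case using L by simp
      qed
    qed (use L in auto)
    then have ev: "\<forall>\<^sub>F k in sequentially. (\<integral>x. min \<bar>u k x\<bar> L \<partial>M) < e / 2"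
      using e by (intro order_tendstoD(2)[OF lim2]) auto
    have bd: "(\<integral>x. \<bar>u k x\<bar> \<partial>M) \<le> (\<integral>x. min \<bar>u k x\<bar> L \<partial>M) + C' / L" for k
    proof -
      have imin: "integrable M (\<lambda>x. min \<bar>u k x\<bar> L)"
        by (rule Bochner_Integration.integrable_bound[OF int(2)[of k]]) (use L in auto)
      have "(\<integral>x. \<bar>u k x\<bar> \<partial>M) \<le> (\<integral>x. min \<bar>u k x\<bar> L + (u k x)\<^sup>2 / L \<partial>M)"
      proof (rule integral_mono)
        fix x
        show "\<bar>u k x\<bar> \<le> min \<bar>u k x\<bar> L + (u k x)\<^sup>2 / L"
        proof (cases "\<bar>u k x\<bar> \<le> L")
          case True then show ?thesis using L by auto
        next
          case False
          then have "\<bar>u k x\<bar> * L \<le> \<bar>u k x\<bar> * \<bar>u k x\<bar>" by (intro mult_left_mono) auto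
          also have "\<dots> = (u k x)\<^sup>2" by (simp add: power2_eq_square)
          finally have "\<bar>u k x\<bar> \<le> (u k x)\<^sup>2 / L" using L by (simp add: field_simps)
          then show ?thesis using False L by auto
        qed
      qed (use int imin in auto)
      also have "\<dots> = (\<integral>x. min \<bar>u k x\<bar> L \<partial>M) + (\<integral>x. (u k x)\<^sup>2 \<partial>M) / L"
        using int imin by (subst Bochner_Integration.integral_add) auto
      also have "\<dots> \<le> (\<integral>x. min \<bar>u k x\<bar> L \<partial>M) + C' / L"
        using C'[of k] L by (simp add: divide_right_mono)
      finally show ?thesis .
    qed
    from ev obtain k0 where k0: "\<And>k. k \<ge> k0 \<Longrightarrow> (\<integral>x. min \<bar>u k x\<bar> L \<partial>M) < e / 2"
      by (auto simp: eventually_sequentially)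
    have "(\<integral>x. \<bar>u k x\<bar> \<partial>M) < e" if "k \<ge> k0" for k
      using bd[of k] k0[OF that] \<open>C' / L \<le> e / 2\<close> by linarith
    then show "\<exists>k0. \<forall>k\<ge>k0. norm ((\<integral>x. \<bar>u k x\<bar> \<partial>M) - 0) < e" by auto
  qed
qed

text \<open>A deterministic counterpart of the Robbins-Siegmund lemma: adding the convergent partial
  sums of \<open>e - b\<close> turns \<open>z\<close> into a decreasing sequence that is bounded
  below.\<close>

lemma almost_decreasing_convergent:
  fixes z a e b :: "nat \<Rightarrow> real"
  assumes step: "\<And>n. z (Suc n) \<le> z n - a n - e n + b n"
    and z: "\<And>n. z n \<ge> 0" and a: "\<And>n. a n \<ge> 0" and "summable e" "summable b"
  shows "convergent z" "summable a"
proof -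
  define r where "r n = (\<Sum>k<n. e k - b k)" for n
  have r: "convergent r"
    using summable_diff[OF assms(4,5)] unfolding r_def by (simp add: summable_iff_convergent)
  then obtain B where B: "\<And>n. \<bar>r n\<bar> \<le> B"
    by (metis BseqE convergent_imp_Bseq real_norm_def)
  \<comment> \<open>The choice \<open>c = 0\<close> yields convergence of \<open>z\<close>; the
    choice \<open>c = a\<close> then yields summability of \<open>a\<close>.\<close>
  have conv: "convergent (\<lambda>n. z n + r n + (\<Sum>k<n. c k))"
    if c: "\<And>n. c n \<le> a n" "\<And>n. c n \<ge> 0" for c
  proof -
    have dec: "decseq (\<lambda>n. z n + r n + (\<Sum>k<n. c k))"
    proof (rule decseq_SucI)
      fix n show "z (Suc n) + r (Suc n) + (\<Sum>k<Suc n. c k) \<le> z n + r n + (\<Sum>k<n. c k)"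
        using step[of n] c(1)[of n] by (simp add: r_def)
    qed
    have bound: "- B \<le> z n + r n + (\<Sum>k<n. c k)" for n
      using z[of n] B[of n] sum_nonneg[of "{..<n}" c] c(2) by (simp add: abs_le_iff)
    obtain l where "(\<lambda>n. z n + r n + (\<Sum>k<n. c k)) \<longlonglongrightarrow> l"
      by (rule decseq_convergent[OF dec, of "- B"]) (auto intro: bound)
    then show ?thesis by (auto simp: convergent_def)
  qed
  have zr: "convergent (\<lambda>n. z n + r n)" using conv[of "\<lambda>_. 0"] a by simp
  show "convergent z" using convergent_diff[OF zr r] by simp
  show "summable a"
    using convergent_diff[OF conv[of a] zr] a by (simp add: summable_iff_convergent)
qed

section \<open>Mirror maps and the Fenchel coupling\<close>

locale mirror =
  fixes X :: "'v::real_normed_vector set" and h :: "'v \<Rightarrow> real" and K :: real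
  assumes compact_X: "compact X" and convex_X: "convex X" and X_ne: "X \<noteq> {}"
    and cont_h: "continuous_on X h" and K_pos: "K > 0" and strong: "strongly_convex_on X K h"
begin

abbreviation "Q \<equiv> mirror_map X h"
abbreviation "conj_h \<equiv> convex_conjugate X h"
abbreviation "\<Phi> \<equiv> fenchel_coupling X h"

lemma continuous_on_pairing: "continuous_on X (\<lambda>x. blinfun_apply y x - h x)"
  by (intro continuous_intros cont_h)

text \<open>\<open>arg_max\<close> is a choice operator, so these properties rest on the existence
  of a maximizer, supplied by compactness and continuity.\<close>

lemma mirror_map_max:
  shows mirror_map_in: "Q y \<in> X"
    and mirror_map_ge: "x \<in> X \<Longrightarrow> blinfun_apply y x - h x \<le> blinfun_apply y (Q y) - h (Q y)"
proof -
  obtain q where q: "q \<in> X" "\<And>x. x \<in> X \<Longrightarrow> blinfun_apply y x - h x \<le> blinfun_apply y q - h q"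
    using continuous_attains_sup[OF compact_X X_ne continuous_on_pairing] by blast
  then have "is_arg_max (\<lambda>x. blinfun_apply y x - h x) (\<lambda>x. x \<in> X) q"
    by (auto simp: is_arg_max_linorder)
  then have "is_arg_max (\<lambda>x. blinfun_apply y x - h x) (\<lambda>x. x \<in> X) (Q y)"
    unfolding mirror_map_def arg_max_def by (rule someI)
  then show "Q y \<in> X" "x \<in> X \<Longrightarrow> blinfun_apply y x - h x \<le> blinfun_apply y (Q y) - h (Q y)"
    by (auto simp: is_arg_max_linorder)
qed

lemma conjugate_eq: "conj_h y = blinfun_apply y (Q y) - h (Q y)"
  unfolding convex_conjugate_def
  by (rule cSup_eq_maximum) (use mirror_map_in mirror_map_ge in auto)

text \<open>\<open>Q y\<close> maximizes a strongly concave function. Comparing it with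
  \<open>t *\<^sub>R p + (1 - t) *\<^sub>R Q y\<close>, dividing by \<open>t\<close> and letting
  \<open>t\<close> tend to \<open>0\<close> gives the full constant \<open>K / 2\<close>.\<close>

lemma mirror_map_quadratic_gap:
  assumes p: "p \<in> X"
  shows "blinfun_apply y p - h p + K / 2 * (norm (Q y - p))\<^sup>2 \<le> conj_h y"
proof -
  let ?q = "Q y" and ?d = "(norm (Q y - p))\<^sup>2"
  have ineq: "K / 2 * (1 - t) * ?d \<le> h p - h ?q - blinfun_apply y (p - ?q)" if t: "0 < t" "t < 1" for t
  proof -
    have "t *\<^sub>R p + (1 - t) *\<^sub>R ?q \<in> X"
      using convex_X mirror_map_in[of y] p t by (auto simp: convex_def)
    from mirror_map_ge[OF this, of y]
    have "t * blinfun_apply y (p - ?q) \<le> h (t *\<^sub>R p + (1 - t) *\<^sub>R ?q) - h ?q"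
      by (simp add: blinfun.bilinear_simps algebra_simps)
    also have "\<dots> \<le> t * h p + (1 - t) * h ?q - 1/2 * K * t * (1 - t) * ?d - h ?q"
      using strong[unfolded strongly_convex_on_def, rule_format, OF p mirror_map_in[of y], of t] t by simp
    finally have "t * (K / 2 * (1 - t) * ?d) \<le> t * (h p - h ?q - blinfun_apply y (p - ?q))"
      by (simp add: algebra_simps)
    then show ?thesis using t by simp
  qed
  have "((\<lambda>t. K / 2 * (1 - t) * ?d) \<longlongrightarrow> K / 2 * (1 - 0) * ?d) (at_right 0)"
    by (intro tendsto_intros)
  moreover have "\<forall>\<^sub>F t in at_right 0. K / 2 * (1 - t) * ?d \<le> h p - h ?q - blinfun_apply y (p - ?q)"
    using ineq by (auto simp: eventually_at_right_field intro: exI[of _ 1])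
  ultimately have "K / 2 * (1 - 0) * ?d \<le> h p - h ?q - blinfun_apply y (p - ?q)"
    by (rule tendsto_upperbound) simp
  then show ?thesis by (simp add: conjugate_eq blinfun.bilinear_simps)
qed

text \<open>This makes convergence of the coupling to \<open>0\<close> force convergence of the
  primal points to \<open>p\<close>.\<close>

lemma fenchel_coupling_ge: "p \<in> X \<Longrightarrow> K / 2 * (norm (Q y - p))\<^sup>2 \<le> \<Phi> p y"
  using mirror_map_quadratic_gap[of p y] unfolding fenchel_coupling_def by simp

lemma fenchel_coupling_nonneg: "p \<in> X \<Longrightarrow> 0 \<le> \<Phi> p y"
  by (rule order_trans[OF _ fenchel_coupling_ge]) (use K_pos in auto)

text \<open>The new point \<open>Q (y + v)\<close> is inserted into the quadratic gap at
  \<open>y\<close>. That gap absorbs the displacement from \<open>Q y\<close> to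
  \<open>Q (y + v)\<close>, at the price of a term quadratic in \<open>v\<close>.\<close>

lemma fenchel_coupling_step:
  "\<Phi> p (y + v) \<le> \<Phi> p y + blinfun_apply v (Q y - p) + (norm v)\<^sup>2 / (2 * K)"
proof -
  let ?q = "Q y" and ?q' = "Q (y + v)"
  have "blinfun_apply y ?q' - h ?q' + K / 2 * (norm (?q - ?q'))\<^sup>2 \<le> conj_h y"
    by (rule mirror_map_quadratic_gap[OF mirror_map_in])
  moreover have "conj_h (y + v) = blinfun_apply y ?q' + blinfun_apply v ?q' - h ?q'"
    by (simp add: conjugate_eq blinfun.bilinear_simps)
  moreover have "blinfun_apply v (?q' - ?q) \<le> norm v * norm (?q - ?q')"
    using norm_blinfun[of v "?q' - ?q"] by (simp add: norm_minus_commute)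
  \<comment> \<open>Young's inequality, with the weight \<open>K\<close> matched to the constant of
    the quadratic gap.\<close>
  moreover have "norm v * norm (?q - ?q') \<le> K / 2 * (norm (?q - ?q'))\<^sup>2 + (norm v)\<^sup>2 / (2 * K)"
  proof -
    have "0 \<le> (norm v - K * norm (?q - ?q'))\<^sup>2 / (2 * K)" using K_pos by simp
    also have "\<dots> = K / 2 * (norm (?q - ?q'))\<^sup>2 + (norm v)\<^sup>2 / (2 * K) - norm v * norm (?q - ?q')"
      using K_pos by (simp add: power2_eq_square field_simps)
    finally show ?thesis by simp
  qed
  ultimately show ?thesis
    unfolding fenchel_coupling_def by (simp add: blinfun.bilinear_simps)
qed

text \<open>Measurability of \<open>Y\<close> is asked for through its real evaluations, a form that
  the recursion of mirror descent preserves.\<close>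

lemma mirror_map_measurable:
  assumes Y: "\<And>x. x \<in> X \<Longrightarrow> (\<lambda>s. blinfun_apply (Y s) x) \<in> borel_measurable S"
  shows "(\<lambda>s. Q (Y s)) \<in> borel_measurable S"
proof -
  obtain d :: "nat \<Rightarrow> 'v" where d: "range d \<subseteq> X" "\<And>x e. x \<in> X \<Longrightarrow> e > 0 \<Longrightarrow> \<exists>i. dist x (d i) < e"
    using compact_countable_dense[OF compact_X X_ne] by metis
  text \<open>\<open>Q y\<close> lies in a closed set \<open>C\<close> iff the maximum over \<open>C \<inter> X\<close> equals that over \<open>X\<close>, and both
    can be tested on countable dense subsets.\<close>
  have sets: "{s \<in> space S. Q (Y s) \<in> C} \<in> sets S" if C: "closed C" for C
  proof (cases "C \<inter> X = {}")
    case True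
    then have "{s \<in> space S. Q (Y s) \<in> C} = {}" using mirror_map_in by auto
    then show ?thesis by (simp only: sets.empty_sets)
  next
    case False
    have cCX: "compact (C \<inter> X)" using C compact_X by (simp add: closed_Int_compact)
    obtain c :: "nat \<Rightarrow> 'v" where c: "range c \<subseteq> C \<inter> X"
        "\<And>x e. x \<in> C \<inter> X \<Longrightarrow> e > 0 \<Longrightarrow> \<exists>i. dist x (c i) < e"
      using compact_countable_dense[OF cCX False] by metis
    have [measurable]: "(\<lambda>s. blinfun_apply (Y s) (d i)) \<in> borel_measurable S"
      "(\<lambda>s. blinfun_apply (Y s) (c i)) \<in> borel_measurable S" for i
      using c(1) d(1) by (auto intro!: Y)
    have iff: "Q y \<in> C \<longleftrightarrow> (\<forall>i n. \<exists>j. blinfun_apply y (c j) - h (c j)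
        > blinfun_apply y (d i) - h (d i) - 1 / real (Suc n))" for y
    proof
      assume q: "Q y \<in> C"
      show "\<forall>i n. \<exists>j. blinfun_apply y (c j) - h (c j)
        > blinfun_apply y (d i) - h (d i) - 1 / real (Suc n)"
      proof (intro allI)
        fix i n
        let ?e = "1 / real (Suc n)"
        have "?e > 0" by simp
        with continuous_on_pairing[of y] mirror_map_in[of y] obtain r where r: "r > 0"
          "\<And>x. x \<in> X \<Longrightarrow> dist x (Q y) < r \<Longrightarrow>
             dist (blinfun_apply y x - h x) (blinfun_apply y (Q y) - h (Q y)) < ?e"
          unfolding continuous_on_iff by blast
        obtain j where j: "dist (Q y) (c j) < r" using c(2)[of "Q y" r] q mirror_map_in r(1) by auto
        have "c j \<in> X" "d i \<in> X" using c(1) d(1) by auto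
        then show "\<exists>j. blinfun_apply y (c j) - h (c j) > blinfun_apply y (d i) - h (d i) - ?e"
          using r(2)[of "c j"] j mirror_map_ge[of "d i" y]
          by (intro exI[of _ j]) (simp add: dist_commute dist_real_def del: of_nat_Suc)
      qed
    next
      assume *: "\<forall>i n. \<exists>j. blinfun_apply y (c j) - h (c j)
        > blinfun_apply y (d i) - h (d i) - 1 / real (Suc n)"
      obtain q where q: "q \<in> C \<inter> X"
        "\<And>x. x \<in> C \<inter> X \<Longrightarrow> blinfun_apply y x - h x \<le> blinfun_apply y q - h q"
        using continuous_attains_sup[OF cCX False continuous_on_subset[OF continuous_on_pairing]] by blast
      have "blinfun_apply y (Q y) - h (Q y) \<le> blinfun_apply y q - h q"
      proof (rule field_le_epsilon)
        fix e :: real assume e: "e > 0"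
        \<comment> \<open>Half of \<open>e\<close> pays for replacing \<open>Q y\<close> by a nearby
          \<open>d i\<close>, the other half for the slack \<open>1 / real (Suc n)\<close>.\<close>
        obtain n where n: "1 / real (Suc n) < e / 2" using e nat_approx_posE[of "e / 2"] by auto
        obtain r where r: "r > 0"
          "\<And>x. x \<in> X \<Longrightarrow> dist x (Q y) < r \<Longrightarrow>
             dist (blinfun_apply y x - h x) (blinfun_apply y (Q y) - h (Q y)) < e / 2"
          using continuous_on_pairing[of y] mirror_map_in[of y] half_gt_zero[OF e]
          unfolding continuous_on_iff by blast
        obtain i where i: "dist (Q y) (d i) < r" using d(2)[OF mirror_map_in r(1)] by blast
        obtain j where j: "blinfun_apply y (c j) - h (c j)
            > blinfun_apply y (d i) - h (d i) - 1 / real (Suc n)" using * by blast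
        have "c j \<in> C \<inter> X" "d i \<in> X" using c(1) d(1) by auto
        then show "blinfun_apply y (Q y) - h (Q y) \<le> blinfun_apply y q - h q + e"
          using r(2)[of "d i"] i j n q(2)[of "c j"] e unfolding dist_commute[of "d i"] dist_real_def
          by linarith
      qed
      \<comment> \<open>Now \<open>q\<close> attains the maximum over \<open>X\<close> as well, and
        the quadratic gap leaves only one maximizer.\<close>
      then have "K / 2 * (norm (Q y - q))\<^sup>2 \<le> 0"
        using mirror_map_quadratic_gap[of q y] q(1) by (simp add: conjugate_eq)
      then have "Q y = q" using K_pos by (simp add: mult_le_0_iff power2_eq_square)
      then show "Q y \<in> C" using q by simp
    qed
    show ?thesis unfolding iff by measurable
  qed
  show ?thesis
  proof (rule borel_measurableI)
    fix U :: "'v set" assume "open U"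
    then have "{s \<in> space S. Q (Y s) \<in> - U} \<in> sets S" by (intro sets) auto
    then have "space S - {s \<in> space S. Q (Y s) \<in> - U} \<in> sets S" by auto
    moreover have "space S - {s \<in> space S. Q (Y s) \<in> - U} = (\<lambda>s. Q (Y s)) -` U \<inter> space S" by auto
    ultimately show "(\<lambda>s. Q (Y s)) -` U \<inter> space S \<in> sets S" by simp
  qed
qed

end

section \<open>Square-integrable martingale differences on a product space\<close>

text \<open>Replacing one coordinate by an independent copy preserves the product law. The inner
  integral plays the role of a conditional expectation given the other coordinates.\<close>

lemma nn_integral_PiM_resample:
  assumes "prob_space M" and [measurable]: "f \<in> borel_measurable (Pi\<^sub>M UNIV (\<lambda>_. M))"
  shows "(\<integral>\<^sup>+w. f w \<partial>Pi\<^sub>M UNIV (\<lambda>_. M)) = (\<integral>\<^sup>+w. \<integral>\<^sup>+z. f (w(k := z)) \<partial>M \<partial>Pi\<^sub>M UNIV (\<lambda>_. M))"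
proof -
  let ?S = "Pi\<^sub>M UNIV (\<lambda>_. M)"
  interpret M: prob_space M by fact
  interpret S: prob_space ?S by (intro prob_space_PiM assms(1))
  interpret pair_sigma_finite M ?S ..
  have upd[measurable]: "(\<lambda>(x, X). X(k := x)) \<in> M \<Otimes>\<^sub>M ?S \<rightarrow>\<^sub>M ?S"
    using measurable_add_dim[of k UNIV "\<lambda>_. M"] measurable_pair_swap_iff[of "\<lambda>(x, X). X(k := x)" M ?S ?S]
    by (simp add: case_prod_beta')
  have eq: "distr (M \<Otimes>\<^sub>M ?S) ?S (\<lambda>(x, X). X(k := x)) = ?S"
    using distr_pair_PiM_eq_PiM[of UNIV "\<lambda>_. M" k] assms(1) by simp
  have "(\<integral>\<^sup>+w. f w \<partial>?S) = (\<integral>\<^sup>+w. f w \<partial>distr (M \<Otimes>\<^sub>M ?S) ?S (\<lambda>(x, X). X(k := x)))"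
    unfolding eq ..
  also have "\<dots> = (\<integral>\<^sup>+p. f ((snd p)(k := fst p)) \<partial>(M \<Otimes>\<^sub>M ?S))"
    by (subst nn_integral_distr[OF upd]) (auto simp: case_prod_beta)
  also have "\<dots> = (\<integral>\<^sup>+w. \<integral>\<^sup>+z. f (w(k := z)) \<partial>M \<partial>?S)"
    by (subst nn_integral_snd[symmetric]) auto
  finally show ?thesis .
qed

lemma integral_PiM_resample:
  fixes f :: "('i \<Rightarrow> 'w) \<Rightarrow> real"
  assumes "prob_space M" and f: "integrable (Pi\<^sub>M UNIV (\<lambda>_. M)) f"
  shows "(\<integral>w. f w \<partial>Pi\<^sub>M UNIV (\<lambda>_. M)) = (\<integral>w. \<integral>z. f (w(k := z)) \<partial>M \<partial>Pi\<^sub>M UNIV (\<lambda>_. M))"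
proof -
  let ?S = "Pi\<^sub>M UNIV (\<lambda>_. M)"
  interpret M: prob_space M by fact
  interpret S: prob_space ?S by (intro prob_space_PiM assms(1))
  interpret pair_sigma_finite M ?S ..
  have [measurable]: "f \<in> borel_measurable ?S" using f by simp
  have upd[measurable]: "(\<lambda>(x, X). X(k := x)) \<in> M \<Otimes>\<^sub>M ?S \<rightarrow>\<^sub>M ?S"
    using measurable_add_dim[of k UNIV "\<lambda>_. M"] measurable_pair_swap_iff[of "\<lambda>(x, X). X(k := x)" M ?S ?S]
    by (simp add: case_prod_beta')
  have eq: "distr (M \<Otimes>\<^sub>M ?S) ?S (\<lambda>(x, X). X(k := x)) = ?S"
    using distr_pair_PiM_eq_PiM[of UNIV "\<lambda>_. M" k] assms(1) by simp
  have int: "integrable (M \<Otimes>\<^sub>M ?S) (\<lambda>(x, X). f (X(k := x)))"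
    using f upd integrable_distr_eq[OF upd, of f] unfolding eq by (simp add: case_prod_beta')
  have "(\<integral>w. f w \<partial>?S) = (\<integral>w. f w \<partial>distr (M \<Otimes>\<^sub>M ?S) ?S (\<lambda>(x, X). X(k := x)))"
    unfolding eq ..
  also have "\<dots> = (\<integral>p. (case p of (x, X) \<Rightarrow> f (X(k := x))) \<partial>(M \<Otimes>\<^sub>M ?S))"
    by (subst integral_distr[OF upd]) (auto simp: case_prod_beta')
  also have "\<dots> = (\<integral>w. \<integral>z. f (w(k := z)) \<partial>M \<partial>?S)"
    by (rule integral_snd[symmetric, OF int])
  finally show ?thesis .
qed

text \<open>This encodes adaptedness without a filtration: only the coordinates \<open>0\<close> to
  \<open>n - 1\<close> matter.\<close>

definition depends_below :: "nat \<Rightarrow> ((nat \<Rightarrow> 'w) \<Rightarrow> 'b) \<Rightarrow> bool" where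
  "depends_below n H \<longleftrightarrow> (\<forall>w w'. (\<forall>i<n. w i = w' i) \<longrightarrow> H w = H w')"

lemma depends_below_upd: "depends_below n H \<Longrightarrow> n \<le> k \<Longrightarrow> H (w(k := z)) = H w"
  unfolding depends_below_def by (metis fun_upd_apply leD)

lemma integrable_mult_of_squares:
  fixes f g :: "'a \<Rightarrow> real"
  assumes [measurable]: "f \<in> borel_measurable M" "g \<in> borel_measurable M"
    and f: "integrable M (\<lambda>w. (f w)\<^sup>2)" and g: "integrable M (\<lambda>w. (g w)\<^sup>2)"
  shows "integrable M (\<lambda>w. f w * g w)"
proof (rule Bochner_Integration.integrable_bound[OF Bochner_Integration.integrable_add[OF f g]])
  have "\<bar>a * b\<bar> \<le> a\<^sup>2 + b\<^sup>2" for a b :: real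
  proof -
    have "2 * \<bar>a * b\<bar> \<le> a\<^sup>2 + b\<^sup>2"
      using sum_squares_bound[of "\<bar>a\<bar>" "\<bar>b\<bar>"] by (simp add: abs_mult mult.assoc)
    then show ?thesis using abs_ge_zero[of "a * b"] by linarith
  qed
  then show "AE w in M. norm (f w * g w) \<le> norm ((f w)\<^sup>2 + (g w)\<^sup>2)" by simp
qed measurable

text \<open>The martingale property is stated by integrating out coordinate \<open>k\<close>, the
  last one on which \<open>d k\<close> may depend, in place of a conditional expectation.\<close>

locale martingale_differences = prob_space M for M :: "'w measure" +
  fixes d :: "nat \<Rightarrow> (nat \<Rightarrow> 'w) \<Rightarrow> real" and c :: "nat \<Rightarrow> real"
  assumes d_measurable[measurable]: "\<And>k. d k \<in> borel_measurable (Pi\<^sub>M UNIV (\<lambda>_. M))"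
    and d_adapted: "\<And>k. depends_below (Suc k) (d k)"
    and d_centered: "\<And>k w. w \<in> space (Pi\<^sub>M UNIV (\<lambda>_. M)) \<Longrightarrow> (\<integral>z. d k (w(k := z)) \<partial>M) = 0"
    and d_square: "\<And>k. (\<integral>\<^sup>+w. ennreal ((d k w)\<^sup>2) \<partial>Pi\<^sub>M UNIV (\<lambda>_. M)) \<le> ennreal (c k)"
    and c_nonneg: "\<And>k. c k \<ge> 0" and c_summable: "summable c"
begin

abbreviation "S \<equiv> Pi\<^sub>M (UNIV :: nat set) (\<lambda>_. M)"

sublocale S: prob_space S
  by (intro prob_space_PiM prob_space_axioms)

lemma d_integrable: "integrable S (\<lambda>w. (d k w)\<^sup>2)"
  by (rule S.integrable_of_second_moment(1)[OF d_measurable d_square])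

lemma d_expectation: "(\<integral>w. (d k w)\<^sup>2 \<partial>S) \<le> c k"
  using d_square[of k] c_nonneg[of k]
  by (subst integral_eq_nn_integral) (auto intro!: enn2real_leI)

text \<open>\<open>H\<close> does not see coordinate \<open>k\<close>. Integrating that coordinate
  first takes \<open>H\<close> outside and leaves the mean of \<open>d k\<close>, which
  vanishes.\<close>

lemma orthogonal:
  assumes [measurable]: "H \<in> borel_measurable S" and H: "depends_below k H"
    and int: "integrable S (\<lambda>w. (H w)\<^sup>2)"
  shows "(\<integral>w. H w * d k w \<partial>S) = 0"
proof -
  have "(\<integral>w. H w * d k w \<partial>S) = (\<integral>w. \<integral>z. H (w(k := z)) * d k (w(k := z)) \<partial>M \<partial>S)"
    by (intro integral_PiM_resample prob_space_axioms integrable_mult_of_squares int d_integrable) auto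
  also have "\<dots> = (\<integral>w. 0 \<partial>S)"
    by (intro Bochner_Integration.integral_cong) (auto simp: depends_below_upd[OF H] d_centered)
  finally show ?thesis by simp
qed

text \<open>Kolmogorov's inequality: stopping the sum once it exceeds \<open>e\<close> preserves orthogonality of the increments,
  so Chebyshev's inequality for the stopped sum suffices.\<close>

lemma maximal_inequality:
  assumes e: "e > 0"
  shows "measure S {w \<in> space S. \<exists>j\<in>{m..n}. \<bar>\<Sum>k=m..<j. d k w\<bar> \<ge> e} \<le> (\<Sum>k=m..<n. c k) / e\<^sup>2"
proof -
  define s where "s j w = (\<Sum>k=m..<j. d k w)" for j w
  \<comment> \<open>\<open>B k\<close> uses only coordinates below \<open>k\<close>, so it is
    predictable. The increment that first carries the sum to level \<open>e\<close> is still
    included in \<open>T\<close>.\<close>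
  define B where "B k w \<longleftrightarrow> (\<forall>i\<in>{m..k}. \<bar>s i w\<bar> < e)" for k w
  define T where "T j w = (\<Sum>k=m..<j. if B k w then d k w else 0)" for j w
  have [measurable]: "s j \<in> borel_measurable S" for j unfolding s_def by measurable
  have [measurable]: "Measurable.pred S (B k)" for k unfolding B_def by measurable
  have [measurable]: "T j \<in> borel_measurable S" for j unfolding T_def by measurable
  have dd: "d k w = d k w'" if "\<forall>i<j. w i = w' i" "k < j" for j k w w'
    using d_adapted[of k] that unfolding depends_below_def by (metis Suc_leI less_le_trans)
  have ss: "s i w = s i w'" if "\<forall>i<j. w i = w' i" "i \<le> j" for i j w w'
    unfolding s_def using dd[OF that(1)] that(2) by (intro sum.cong) auto
  have BB: "B k w \<longleftrightarrow> B k w'" if "\<forall>i<j. w i = w' i" "k \<le> j" for k j w w'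
    unfolding B_def using ss[OF that(1)] that(2) by (intro ball_cong) auto
  have TT: "depends_below j (T j)" for j
    unfolding depends_below_def T_def using dd BB by (intro allI impI sum.cong) auto
  have *: "integrable S (\<lambda>w. (T j w)\<^sup>2) \<and> (\<integral>w. (T j w)\<^sup>2 \<partial>S) \<le> (\<Sum>k=m..<j. c k)" for j
  proof (induction j)
    case 0 then show ?case by (simp add: T_def)
  next
    case (Suc j)
    show ?case
    proof (cases "m \<le> j")
      case False then show ?thesis by (simp add: T_def)
    next
      case True
      let ?d = "\<lambda>w. if B j w then d j w else 0" and ?H = "\<lambda>w. if B j w then T j w else 0"
      \<comment> \<open>The cross term has mean zero by orthogonality, so second moments of the
        stopped sum add up.\<close>
      have sq: "(T (Suc j) w)\<^sup>2 = (T j w)\<^sup>2 + 2 * (?H w * d j w) + (?d w)\<^sup>2" for w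
        using True by (simp add: T_def power2_eq_square algebra_simps)
      have iH: "integrable S (\<lambda>w. (?H w)\<^sup>2)"
        by (rule Bochner_Integration.integrable_bound[OF conjunct1[OF Suc.IH]]) auto
      have id: "integrable S (\<lambda>w. (?d w)\<^sup>2)"
        by (rule Bochner_Integration.integrable_bound[OF d_integrable[of j]]) auto
      have iHd: "integrable S (\<lambda>w. ?H w * d j w)"
        by (intro integrable_mult_of_squares iH d_integrable) auto
      have "depends_below j ?H"
        using TT BB unfolding depends_below_def by (metis order_refl)
      then have 0: "(\<integral>w. ?H w * d j w \<partial>S) = 0"
        by (intro orthogonal iH) auto
      have "(\<integral>w. (?d w)\<^sup>2 \<partial>S) \<le> (\<integral>w. (d j w)\<^sup>2 \<partial>S)"
        by (intro integral_mono id d_integrable) auto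
      with d_expectation[of j] have "(\<integral>w. (?d w)\<^sup>2 \<partial>S) \<le> c j" by simp
      moreover have "(\<integral>w. (T (Suc j) w)\<^sup>2 \<partial>S) = (\<integral>w. (T j w)\<^sup>2 \<partial>S) + (\<integral>w. (?d w)\<^sup>2 \<partial>S)"
        unfolding sq using Suc.IH iHd id 0 by simp
      moreover have "integrable S (\<lambda>w. (T (Suc j) w)\<^sup>2)"
        unfolding sq using Suc.IH iHd id by (intro Bochner_Integration.integrable_add) auto
      ultimately show ?thesis using Suc.IH True by simp
    qed
  qed
  have sub: "e \<le> \<bar>T n w\<bar>" if "\<exists>j\<in>{m..n}. \<bar>s j w\<bar> \<ge> e" for w
  proof -
    define P where "P j \<longleftrightarrow> m \<le> j \<and> \<bar>s j w\<bar> \<ge> e" for j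
    define j where "j = (LEAST j. P j)"
    from that obtain i where i: "P i" "i \<le> n" unfolding P_def by auto
    have j: "P j" unfolding j_def by (rule LeastI[of P, OF i(1)])
    have jn: "j \<le> n" unfolding j_def using Least_le[of P, OF i(1)] i(2) by simp
    have min: "\<not> P k" if "k < j" for k using not_less_Least that unfolding j_def by blast
    \<comment> \<open>Here \<open>j\<close> is the first crossing time. The indicators select
      exactly the terms before it, whence \<open>T n w = s j w\<close>.\<close>
    have Bk: "B k w \<longleftrightarrow> k < j" if "m \<le> k" for k
    proof
      assume "B k w" then show "k < j" using j unfolding P_def B_def by (meson atLeastAtMost_iff leI not_le)
    next
      assume "k < j" then show "B k w" unfolding B_def using min unfolding P_def
        by (meson atLeastAtMost_iff le_less_trans not_le)
    qed
    have "T n w = (\<Sum>k=m..<n. if k < j then d k w else 0)"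
      unfolding T_def using Bk by (intro sum.cong) auto
    also have "\<dots> = (\<Sum>k\<in>{k\<in>{m..<n}. k < j}. d k w)"
      by (subst sum.inter_filter) auto
    also have "{k\<in>{m..<n}. k < j} = {m..<j}" using jn by auto
    finally show ?thesis using j unfolding s_def P_def by simp
  qed
  have "measure S {w \<in> space S. \<exists>j\<in>{m..n}. \<bar>s j w\<bar> \<ge> e} \<le> measure S {w \<in> space S. e \<le> \<bar>T n w\<bar>}"
    by (intro S.finite_measure_mono) (use sub in auto)
  also have "\<dots> \<le> (\<integral>w. (T n w)\<^sup>2 \<partial>S) / e\<^sup>2"
    using * e by (intro S.second_moment_method) auto
  also have "\<dots> \<le> (\<Sum>k=m..<n. c k) / e\<^sup>2"
    using * by (intro divide_right_mono) auto
  finally show ?thesis unfolding s_def .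
qed

text \<open>The tails of \<open>c\<close> tend to \<open>0\<close>, so the maximal inequality makes
  late oscillations of the partial sums improbable; Cauchy's criterion concludes.\<close>

lemma AE_summable: "AE w in S. summable (\<lambda>k. d k w)"
proof -
  have "AE w in S. \<exists>m. \<forall>j\<ge>m. \<bar>\<Sum>k=m..<j. d k w\<bar> < e" if e: "e > 0" for e
  proof -
    define E where "E m n = {w \<in> space S. \<exists>j\<in>{m..n}. \<bar>\<Sum>k=m..<j. d k w\<bar> \<ge> e}" for m n
    have [measurable]: "E m n \<in> sets S" for m n unfolding E_def by measurable
    define A where "A = (\<Inter>m. \<Union>n. E m n)"
    have [measurable]: "A \<in> sets S" unfolding A_def by measurable
    \<comment> \<open>The events increase with \<open>n\<close> and the bound from the maximal
      inequality is uniform in \<open>n\<close>, so it passes to their union.\<close>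
    have bd: "measure S (\<Union>n. E m n) \<le> (\<Sum>k. c (k + m)) / e\<^sup>2" for m
    proof (rule LIMSEQ_le_const2[OF S.finite_Lim_measure_incseq])
      show "incseq (E m)" by (rule incseq_SucI) (auto simp: E_def)
      show "\<exists>N. \<forall>n\<ge>N. measure S (E m n) \<le> (\<Sum>k. c (k + m)) / e\<^sup>2"
      proof (intro exI allI impI)
        fix n
        have "(\<Sum>k=m..<n. c k) = (\<Sum>k<n - m. c (k + m))"
          by (rule sum.reindex_bij_witness[of _ "\<lambda>k. k + m" "\<lambda>k. k - m"]) auto
        also have "\<dots> \<le> (\<Sum>k. c (k + m))"
          using c_nonneg c_summable by (intro sum_le_suminf) (auto simp: summable_iff_shift)
        finally have "(\<Sum>k=m..<n. c k) / e\<^sup>2 \<le> (\<Sum>k. c (k + m)) / e\<^sup>2"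
          by (intro divide_right_mono) auto
        with maximal_inequality[OF e, of m n]
        show "measure S (E m n) \<le> (\<Sum>k. c (k + m)) / e\<^sup>2" unfolding E_def by linarith
      qed
    qed auto
    have "measure S A \<le> 0"
    proof (rule LIMSEQ_le_const)
      have "(\<lambda>m. (\<Sum>k. c (k + m)) / e\<^sup>2) \<longlonglongrightarrow> 0 / e\<^sup>2"
        using e by (intro tendsto_divide suminf_exist_split2 c_summable tendsto_const) auto
      then show "(\<lambda>m. (\<Sum>k. c (k + m)) / e\<^sup>2) \<longlonglongrightarrow> 0" by simp
      have "measure S A \<le> measure S (\<Union>n. E m n)" for m
        by (intro S.finite_measure_mono) (auto simp: A_def)
      then show "\<exists>N. \<forall>m\<ge>N. measure S A \<le> (\<Sum>k. c (k + m)) / e\<^sup>2"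
        using bd by (meson order_trans)
    qed
    then have "A \<in> null_sets S"
      by (auto simp: null_sets_def S.emeasure_eq_measure intro: antisym)
    then show ?thesis
    proof (rule AE_I')
      show "{w \<in> space S. \<not> (\<exists>m. \<forall>j\<ge>m. \<bar>\<Sum>k=m..<j. d k w\<bar> < e)} \<subseteq> A"
        unfolding A_def E_def by (fastforce simp: not_less)
    qed
  qed
  \<comment> \<open>Restricting to the thresholds \<open>1 / real (Suc r)\<close> leaves a countable
    union of null sets.\<close>
  then have "AE w in S. \<forall>r::nat. \<exists>m. \<forall>j\<ge>m. \<bar>\<Sum>k=m..<j. d k w\<bar> < 1 / real (Suc r)"
    by (subst AE_all_countable) auto
  then show ?thesis
  proof eventually_elim
    case (elim w)
    show ?case unfolding summable_Cauchy
    proof (intro allI impI)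
      fix e :: real assume "e > 0"
      then obtain r where r: "1 / real (Suc r) < e / 2" using nat_approx_posE[of "e / 2"] by auto
      from elim obtain N where N: "\<And>j. j \<ge> N \<Longrightarrow> \<bar>\<Sum>k=N..<j. d k w\<bar> < 1 / real (Suc r)" by blast
      have "\<bar>\<Sum>k=m..<n. d k w\<bar> < e" if "m \<ge> N" for m n
      proof (cases "m \<le> n")
        case True
        have "(\<Sum>k=N..<n. d k w) = (\<Sum>k=N..<m. d k w) + (\<Sum>k=m..<n. d k w)"
          using True that by (simp add: sum.atLeastLessThan_concat)
        then show ?thesis using N[of m] N[of n] r that True by linarith
      qed (use \<open>e > 0\<close> in simp)
      then show "\<exists>N. \<forall>m\<ge>N. \<forall>n. norm (\<Sum>k=m..<n. d k w) < e" by auto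
    qed
  qed
qed

end

section \<open>Differentiation under the expectation\<close>

text \<open>Since \<open>X\<close> may have empty interior, uniqueness holds only in feasible
  directions. It comes from the one-dimensional case along the segment from \<open>x\<close> to
  \<open>p\<close>.\<close>

lemma has_derivative_within_convex_unique:
  fixes f :: "'v::real_normed_vector \<Rightarrow> real"
  assumes "convex X" "x \<in> X" "p \<in> X"
    and f1: "(f has_derivative f1) (at x within X)" and f2: "(f has_derivative f2) (at x within X)"
  shows "f1 (p - x) = f2 (p - x)"
proof -
  let ?r = "\<lambda>t. x + t *\<^sub>R (p - x)"
  have r: "?r ` {0..1} \<subseteq> X"
    using assms(1-3) by (auto simp: algebra_simps convex_alt)
  have vd: "((\<lambda>t. f (?r t)) has_vector_derivative g (p - x)) (at 0 within {0..1})"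
    if g: "(f has_derivative g) (at x within X)" for g
  proof -
    have "(?r has_derivative (\<lambda>t. t *\<^sub>R (p - x))) (at 0 within {0..1})"
      by (auto intro!: derivative_eq_intros)
    moreover have "(f has_derivative g) (at (?r 0) within ?r ` {0..1})"
      using has_derivative_subset[OF g r] by simp
    ultimately have "((f \<circ> ?r) has_derivative (g \<circ> (\<lambda>t. t *\<^sub>R (p - x)))) (at 0 within {0..1})"
      by (rule diff_chain_within)
    then show ?thesis
      using has_derivative_linear[OF g]
      by (simp add: has_vector_derivative_def comp_def linear_cmul)
  qed
  show ?thesis
    by (rule vector_derivative_unique_within_closed_interval[of 0 1 0 "\<lambda>t. f (?r t)"])
       (use vd[OF f1] vd[OF f2] in auto)
qed

text \<open>The Cauchy--Schwarz inequality on \<open>{0..1}\<close>, obtained by integrating \<open>2 * c * \<phi>' - c\<^sup>2 \<le> \<phi>'\<^sup>2\<close>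
  where \<open>c\<close> is the increment of \<open>\<phi>\<close>.\<close>

lemma square_increment_le:
  fixes \<phi> :: "real \<Rightarrow> real"
  assumes d: "\<And>t. t \<in> {0..1} \<Longrightarrow> (\<phi> has_vector_derivative \<phi>' t) (at t within {0..1})"
    and cont: "continuous_on {0..1} \<phi>'"
  shows "ennreal ((\<phi> 1 - \<phi> 0)\<^sup>2) \<le> (\<integral>\<^sup>+t. ennreal ((\<phi>' t)\<^sup>2) * indicator {0..1} t \<partial>lborel)"
proof -
  let ?c = "\<phi> 1 - \<phi> 0"
  let ?I = "\<lambda>f. (\<lambda>t::real. indicator {0..1} t *\<^sub>R (f t :: real))"
  have 1: "has_bochner_integral lborel (?I \<phi>') ?c"
    by (rule has_bochner_integral_FTC_Icc) (use d cont in auto)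
  have 2: "has_bochner_integral lborel (?I (\<lambda>_. 1)) 1"
    using has_bochner_integral_FTC_Icc[of 0 1 "\<lambda>t. t" "\<lambda>_. 1"] by (auto intro!: derivative_eq_intros)
  have 3: "integrable lborel (?I (\<lambda>t. (\<phi>' t)\<^sup>2))"
    using borel_integrable_atLeastAtMost'[of 0 1 "\<lambda>t. (\<phi>' t)\<^sup>2"] cont
    unfolding set_integrable_def by (auto intro!: continuous_intros)
  have 4: "has_bochner_integral lborel (\<lambda>t. (2 * ?c) *\<^sub>R ?I \<phi>' t - ?c\<^sup>2 *\<^sub>R ?I (\<lambda>_. 1) t) ((2 * ?c) *\<^sub>R ?c - ?c\<^sup>2 *\<^sub>R 1)"
    by (intro has_bochner_integral_diff has_bochner_integral_scaleR_right 1 2)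
  have "?c\<^sup>2 = (\<integral>t. (2 * ?c) *\<^sub>R ?I \<phi>' t - ?c\<^sup>2 *\<^sub>R ?I (\<lambda>_. 1) t \<partial>lborel)"
    using has_bochner_integral_integral_eq[OF 4] by (simp add: power2_eq_square)
  also have "\<dots> \<le> (\<integral>t. ?I (\<lambda>t. (\<phi>' t)\<^sup>2) t \<partial>lborel)"
  proof (rule integral_mono[OF _ 3])
    show "integrable lborel (\<lambda>t. (2 * ?c) *\<^sub>R ?I \<phi>' t - ?c\<^sup>2 *\<^sub>R ?I (\<lambda>_. 1) t)"
      using 4 by (auto simp: has_bochner_integral_iff)
    fix t
    have "2 * c * a - c\<^sup>2 \<le> a\<^sup>2" for a c :: real
      using zero_le_power2[of "a - c"] by (simp add: power2_diff algebra_simps)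
    from this[of ?c "\<phi>' t"] have "2 * ?c * \<phi>' t - ?c\<^sup>2 \<le> (\<phi>' t)\<^sup>2" .
    then show "(2 * ?c) *\<^sub>R ?I \<phi>' t - ?c\<^sup>2 *\<^sub>R ?I (\<lambda>_. 1) t \<le> ?I (\<lambda>t. (\<phi>' t)\<^sup>2) t"
      by (auto simp: indicator_def)
  qed
  finally have "ennreal (?c\<^sup>2) \<le> ennreal (\<integral>t. ?I (\<lambda>t. (\<phi>' t)\<^sup>2) t \<partial>lborel)" by (rule ennreal_leI)
  also have "\<dots> = (\<integral>\<^sup>+t. ennreal (?I (\<lambda>t. (\<phi>' t)\<^sup>2) t) \<partial>lborel)"
    by (rule nn_integral_eq_integral[OF 3, symmetric]) auto
  also have "\<dots> = (\<integral>\<^sup>+t. ennreal ((\<phi>' t)\<^sup>2) * indicator {0..1} t \<partial>lborel)"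
    by (intro nn_integral_cong) (auto simp: indicator_def)
  finally show ?thesis .
qed

text \<open>It supplies the second moment bound of \<open>tendsto_expectation_zero\<close> for
  differences of two controlled terms.\<close>

lemma nn_integral_square_sum_le:
  fixes u :: "'w \<Rightarrow> real"
  assumes [measurable]: "a \<in> borel_measurable M" "b \<in> borel_measurable M"
    and "AE z in M. \<bar>u z\<bar> \<le> \<bar>a z\<bar> + \<bar>b z\<bar>"
    and a: "(\<integral>\<^sup>+z. ennreal ((a z)\<^sup>2) \<partial>M) \<le> ennreal C" and b: "(\<integral>\<^sup>+z. ennreal ((b z)\<^sup>2) \<partial>M) \<le> ennreal C"
    and "C \<ge> 0"
  shows "(\<integral>\<^sup>+z. ennreal ((u z)\<^sup>2) \<partial>M) \<le> ennreal (4 * C)"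
proof -
  have "(\<integral>\<^sup>+z. ennreal ((u z)\<^sup>2) \<partial>M) \<le> (\<integral>\<^sup>+z. 2 * ennreal ((a z)\<^sup>2) + 2 * ennreal ((b z)\<^sup>2) \<partial>M)"
  proof (rule nn_integral_mono_AE, use assms(3) in eventually_elim)
    case (elim z)
    have "(u z)\<^sup>2 \<le> (\<bar>a z\<bar> + \<bar>b z\<bar>)\<^sup>2" using elim by (metis abs_ge_zero power2_abs power_mono)
    also have "\<dots> \<le> 2 * (a z)\<^sup>2 + 2 * (b z)\<^sup>2"
      using sum_squares_bound[of "\<bar>a z\<bar>" "\<bar>b z\<bar>"] by (simp add: power2_sum)
    finally have "ennreal ((u z)\<^sup>2) \<le> ennreal (2 * (a z)\<^sup>2 + 2 * (b z)\<^sup>2)" by (rule ennreal_leI)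
    then show ?case by (simp add: ennreal_plus ennreal_mult del: ennreal_plus[symmetric])
  qed
  also have "\<dots> = 2 * (\<integral>\<^sup>+z. ennreal ((a z)\<^sup>2) \<partial>M) + 2 * (\<integral>\<^sup>+z. ennreal ((b z)\<^sup>2) \<partial>M)"
    by (simp add: nn_integral_add nn_integral_cmult)
  also have "\<dots> \<le> 2 * ennreal C + 2 * ennreal C"
    by (intro add_mono mult_left_mono a b) auto
  also have "\<dots> = ennreal (4 * C)"
    using \<open>C \<ge> 0\<close> by (simp add: ennreal_mult flip: distrib_right)
  finally show ?thesis .
qed

text \<open>Continuity of the gradient is required at every sample point, as the Caratheodory
  argument demands, while the derivative property is required almost everywhere.\<close>

locale stochastic_gradient = prob_space M for M :: "'w measure" +
  fixes X :: "'v::real_normed_vector set" and F :: "'v \<Rightarrow> 'w \<Rightarrow> real"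
    and G :: "'v \<Rightarrow> 'w \<Rightarrow> 'v \<Rightarrow>\<^sub>L real" and V :: real
  assumes compact_X: "compact X" and convex_X: "convex X"
    and F_integrable: "\<And>x. x \<in> X \<Longrightarrow> integrable M (F x)"
    and G_measurable: "\<And>x. x \<in> X \<Longrightarrow> G x \<in> borel_measurable M"
    and G_continuous: "\<And>z. z \<in> space M \<Longrightarrow> continuous_on X (\<lambda>x. G x z)"
    and G_derivative: "AE z in M. \<forall>x\<in>X. ((\<lambda>x. F x z) has_derivative blinfun_apply (G x z)) (at x within X)"
    and G_square: "\<And>x. x \<in> X \<Longrightarrow> (\<integral>\<^sup>+z. ennreal ((norm (G x z))\<^sup>2) \<partial>M) \<le> ennreal (V\<^sup>2)"
begin

abbreviation "f \<equiv> objective M F"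

text \<open>Taking the expectation direction by direction keeps all integrals real valued.\<close>

definition mean_gradient :: "'v \<Rightarrow> 'v \<Rightarrow> real" where
  "mean_gradient x v = (\<integral>z. blinfun_apply (G x z) v \<partial>M)"

lemma G_apply_measurable: "x \<in> X \<Longrightarrow> (\<lambda>z. blinfun_apply (G x z) v) \<in> borel_measurable M"
  by (rule measurable_compose[OF G_measurable]) (auto intro!: borel_measurable_continuous_onI continuous_intros)

lemma G_norm_measurable: "x \<in> X \<Longrightarrow> (\<lambda>z. norm (G x z)) \<in> borel_measurable M"
  by (rule measurable_compose[OF G_measurable]) (auto intro!: borel_measurable_continuous_onI continuous_intros)

lemma G_norm_integrable: "x \<in> X \<Longrightarrow> integrable M (\<lambda>z. norm (G x z))"
  by (rule integrable_of_second_moment(2)[OF G_norm_measurable G_square])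

lemma G_apply_integrable: "x \<in> X \<Longrightarrow> integrable M (\<lambda>z. blinfun_apply (G x z) v)"
  by (rule Bochner_Integration.integrable_bound[OF integrable_mult_left[where c="norm v", OF G_norm_integrable]])
     (auto simp: G_apply_measurable abs_mult norm_blinfun[of "G x _" v, unfolded real_norm_def])

lemma mean_gradient_bounded_linear:
  assumes x: "x \<in> X"
  shows "bounded_linear (mean_gradient x)"
proof (rule bounded_linear_intro[where K="\<integral>z. norm (G x z) \<partial>M"])
  fix v w :: 'v and r :: real
  show "mean_gradient x (v + w) = mean_gradient x v + mean_gradient x w"
    unfolding mean_gradient_def using G_apply_integrable[OF x] by (simp add: blinfun.bilinear_simps)
  show "mean_gradient x (r *\<^sub>R v) = r *\<^sub>R mean_gradient x v"
    unfolding mean_gradient_def by (simp add: blinfun.bilinear_simps)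
  have "norm (mean_gradient x v) \<le> (\<integral>z. norm (blinfun_apply (G x z) v) \<partial>M)"
    unfolding mean_gradient_def by (rule integral_norm_bound)
  also have "\<dots> \<le> (\<integral>z. norm (G x z) * norm v \<partial>M)"
    by (intro integral_mono integrable_norm G_apply_integrable x integrable_mult_left G_norm_integrable norm_blinfun)
  finally show "norm (mean_gradient x v) \<le> norm v * (\<integral>z. norm (G x z) \<partial>M)" by (simp add: mult.commute)
qed

lemma G_apply_square:
  assumes x: "x \<in> X" and v: "norm v \<le> R"
  shows "(\<integral>\<^sup>+z. ennreal ((blinfun_apply (G x z) v)\<^sup>2) \<partial>M) \<le> ennreal (R\<^sup>2 * V\<^sup>2)"
proof -
  have "(\<integral>\<^sup>+z. ennreal ((blinfun_apply (G x z) v)\<^sup>2) \<partial>M) \<le> (\<integral>\<^sup>+z. ennreal (R\<^sup>2) * ennreal ((norm (G x z))\<^sup>2) \<partial>M)"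
  proof (rule nn_integral_mono)
    fix z
    have "\<bar>blinfun_apply (G x z) v\<bar> \<le> norm (G x z) * norm v"
      using norm_blinfun[of "G x z" v] by simp
    also have "\<dots> \<le> norm (G x z) * R" using v by (intro mult_left_mono) auto
    finally have "\<bar>blinfun_apply (G x z) v\<bar>\<^sup>2 \<le> (norm (G x z) * R)\<^sup>2" by (intro power_mono) auto
    then show "ennreal ((blinfun_apply (G x z) v)\<^sup>2) \<le> ennreal (R\<^sup>2) * ennreal ((norm (G x z))\<^sup>2)"
      by (simp add: power_mult_distrib mult.commute flip: ennreal_mult)
  qed
  also have "\<dots> = ennreal (R\<^sup>2) * (\<integral>\<^sup>+z. ennreal ((norm (G x z))\<^sup>2) \<partial>M)"
    using G_norm_measurable[OF x] by (intro nn_integral_cmult) auto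
  also have "\<dots> \<le> ennreal (R\<^sup>2) * ennreal (V\<^sup>2)" by (intro mult_left_mono G_square x) auto
  finally show ?thesis by (simp add: ennreal_mult)
qed

text \<open>The pairings converge pointwise by continuity of \<open>G\<close>, and bounded second
  moments make them uniformly integrable. The point and the direction vary together because the
  pairing with \<open>x - p\<close> moves both.\<close>

lemma mean_gradient_tendsto:
  assumes xs: "\<And>k. xs k \<in> X" "xs \<longlonglongrightarrow> x" "x \<in> X" and vs: "vs \<longlonglongrightarrow> v"
  shows "(\<lambda>k. mean_gradient (xs k) (vs k)) \<longlonglongrightarrow> mean_gradient x v"
proof -
  obtain R0 where R0: "\<And>k. norm (vs k) \<le> R0"
    using convergent_imp_Bseq[OF convergentI[OF vs]] by (metis BseqE)
  define R where "R = max R0 (norm v)"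
  have R: "norm (vs k) \<le> R" "norm v \<le> R" for k using R0[of k] by (auto simp: R_def)
  let ?u = "\<lambda>k z. blinfun_apply (G (xs k) z) (vs k) - blinfun_apply (G x z) v"
  have lim: "(\<lambda>k. \<integral>z. \<bar>?u k z\<bar> \<partial>M) \<longlonglongrightarrow> 0"
  proof (rule tendsto_expectation_zero)
    show "?u k \<in> borel_measurable M" for k
      by (intro borel_measurable_diff G_apply_measurable xs)
    show "AE z in M. (\<lambda>k. ?u k z) \<longlonglongrightarrow> 0"
    proof (rule AE_I2)
      fix z assume "z \<in> space M"
      from continuous_on_tendsto_compose[OF G_continuous[OF this] xs(2,3)]
      have "(\<lambda>k. G (xs k) z) \<longlonglongrightarrow> G x z" using xs(1) by simp
      from tendsto_diff[OF blinfun.tendsto[OF this vs] tendsto_const[of "blinfun_apply (G x z) v"]]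
      show "(\<lambda>k. ?u k z) \<longlonglongrightarrow> 0" by simp
    qed
    show "(\<integral>\<^sup>+z. ennreal ((?u k z)\<^sup>2) \<partial>M) \<le> ennreal (4 * (R\<^sup>2 * V\<^sup>2))" for k
      by (rule nn_integral_square_sum_le[OF G_apply_measurable[OF xs(1)[of k], of "vs k"] G_apply_measurable[OF xs(3), of v]
            _ G_apply_square[OF xs(1) R(1)] G_apply_square[OF xs(3) R(2)]]) auto
  qed
  have "\<bar>mean_gradient (xs k) (vs k) - mean_gradient x v\<bar> \<le> (\<integral>z. \<bar>?u k z\<bar> \<partial>M)" for k
    unfolding mean_gradient_def
    by (subst Bochner_Integration.integral_diff[symmetric]) (auto intro!: G_apply_integrable xs)
  then have "(\<lambda>k. \<bar>mean_gradient (xs k) (vs k) - mean_gradient x v\<bar>) \<longlonglongrightarrow> 0"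
    by (intro real_tendsto_sandwich[OF _ _ tendsto_const lim]) (auto intro!: always_eventually)
  then have "(\<lambda>k. mean_gradient (xs k) (vs k) - mean_gradient x v) \<longlonglongrightarrow> 0"
    by (simp add: tendsto_rabs_zero_iff)
  then show ?thesis by (rule Lim_null[THEN iffD2])
qed

text \<open>The derivative is integrated along the segment from \<open>x\<close> to
  \<open>y\<close>; Cauchy-Schwarz and Tonelli then reduce the claim to the second moment of the
  gradient. This controls difference quotients without a pointwise dominating function.\<close>

lemma increment_square:
  assumes x: "x \<in> X" and y: "y \<in> X"
  shows "(\<integral>\<^sup>+z. ennreal ((F y z - F x z)\<^sup>2) \<partial>M) \<le> ennreal ((norm (y - x))\<^sup>2 * V\<^sup>2)"
proof -
  define r where "r t = x + t *\<^sub>R (y - x)" for t :: real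
  \<comment> \<open>Clamping the parameter to \<open>{0..1}\<close> keeps the path in
    \<open>X\<close>, so that \<open>D\<close> is jointly measurable over the whole real
    line.\<close>
  define cl where "cl t = max 0 (min 1 t)" for t :: real
  have rX: "r t \<in> X" if "0 \<le> t" "t \<le> 1" for t
    using convex_X x y that unfolding r_def by (auto simp: algebra_simps convex_alt)
  have rclX: "r (cl t) \<in> X" for t by (rule rX) (auto simp: cl_def)
  define D where "D t z = blinfun_apply (G (r (cl t)) z) (y - x)" for t z
  have cont: "continuous_on UNIV (\<lambda>t. r (cl t))"
    unfolding r_def cl_def by (intro continuous_intros)
  interpret pair_sigma_finite lborel M ..
  have [measurable]: "(\<lambda>p. D (fst p) (snd p)) \<in> borel_measurable (lborel \<Otimes>\<^sub>M M)"
    unfolding D_def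
  proof (rule borel_measurable_Caratheodory[OF compact_X, where Z="\<lambda>p. r (cl (fst p))" and w=snd and M=M and
        G="\<lambda>x' z. blinfun_apply (G x' z) (y - x)"], goal_cases)
    case 1
    show ?case
      by (rule measurable_compose[OF measurable_fst])
         (use borel_measurable_continuous_onI[OF cont] in simp)
  next
    case (5 z) then show ?case by (intro continuous_intros G_continuous)
  qed (auto simp: rclX G_apply_measurable)
  have "(\<integral>\<^sup>+z. ennreal ((F y z - F x z)\<^sup>2) \<partial>M) \<le> (\<integral>\<^sup>+z. \<integral>\<^sup>+t. ennreal ((D t z)\<^sup>2) * indicator {0..1} t \<partial>lborel \<partial>M)"
  proof (rule nn_integral_mono_AE, use G_derivative AE_space[of M] in eventually_elim)
    case (elim z)
    have "ennreal ((F (r 1) z - F (r 0) z)\<^sup>2) \<le> (\<integral>\<^sup>+t. ennreal ((D t z)\<^sup>2) * indicator {0..1} t \<partial>lborel)"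
    proof (rule square_increment_le[of "\<lambda>t. F (r t) z" "\<lambda>t. D t z"])
      show "continuous_on {0..1} (\<lambda>t. D t z)"
        unfolding D_def
        by (intro continuous_intros continuous_on_compose2[OF G_continuous[OF elim(2)]]
             continuous_on_subset[OF cont]) (auto intro: rclX)
      fix t :: real assume t: "t \<in> {0..1}"
      have cl: "cl t = t" using t by (auto simp: cl_def)
      have g: "((\<lambda>x. F x z) has_derivative blinfun_apply (G (r t) z)) (at (r t) within r ` {0..1})"
        by (rule has_derivative_subset[OF elim(1)[rule_format, OF rX]]) (use t rX in auto)
      have "(r has_derivative (\<lambda>s. s *\<^sub>R (y - x))) (at t within {0..1})"
        unfolding r_def by (auto intro!: derivative_eq_intros)
      from diff_chain_within[OF this g]
      show "((\<lambda>t. F (r t) z) has_vector_derivative D t z) (at t within {0..1})"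
        by (simp add: has_vector_derivative_def comp_def D_def cl blinfun.scaleR_right)
    qed
    then show ?case by (simp add: r_def)
  qed
  also have "\<dots> = (\<integral>\<^sup>+t. \<integral>\<^sup>+z. ennreal ((D t z)\<^sup>2) * indicator {0..1} t \<partial>M \<partial>lborel)"
    by (rule Fubini') measurable
  also have "\<dots> \<le> (\<integral>\<^sup>+t. ennreal ((norm (y - x))\<^sup>2 * V\<^sup>2) * indicator {0..1} (t::real) \<partial>lborel)"
  proof (rule nn_integral_mono)
    fix t :: real
    have "(\<lambda>z. D t z) \<in> borel_measurable M" unfolding D_def by (rule G_apply_measurable[OF rclX])
    then have "(\<integral>\<^sup>+z. ennreal ((D t z)\<^sup>2) * indicator {0..1} t \<partial>M) = (\<integral>\<^sup>+z. ennreal ((D t z)\<^sup>2) \<partial>M) * indicator {0..1} t"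
      by (intro nn_integral_multc) auto
    also have "\<dots> \<le> ennreal ((norm (y - x))\<^sup>2 * V\<^sup>2) * indicator {0..1} t"
      unfolding D_def by (intro mult_right_mono G_apply_square rclX) auto
    finally show "(\<integral>\<^sup>+z. ennreal ((D t z)\<^sup>2) * indicator {0..1} t \<partial>M) \<le> ennreal ((norm (y - x))\<^sup>2 * V\<^sup>2) * indicator {0..1} t" .
  qed
  also have "\<dots> = ennreal ((norm (y - x))\<^sup>2 * V\<^sup>2)"
    by (simp add: nn_integral_cmult_indicator)
  finally show ?thesis .
qed

text \<open>The normalized remainders tend to \<open>0\<close> almost everywhere with second moments
  at most \<open>4 * V\<^sup>2\<close>. Uniform integrability takes the place of dominated
  convergence.\<close>

lemma objective_has_derivative:
  assumes x: "x \<in> X"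
  shows "(f has_derivative mean_gradient x) (at x within X)"
  unfolding has_derivative_within
proof (intro conjI mean_gradient_bounded_linear x)
  show "((\<lambda>y. (1 / norm (y - x)) *\<^sub>R (f y - (f x + mean_gradient x (y - x)))) \<longlongrightarrow> 0) (at x within X)"
    unfolding tendsto_at_iff_sequentially comp_def
  proof (intro allI impI)
    fix ys assume "\<forall>i. ys i \<in> X - {x}" and lim: "ys \<longlonglongrightarrow> x"
    then have ys: "ys k \<in> X" "ys k \<noteq> x" for k by auto
    let ?n = "\<lambda>k. norm (ys k - x)"
    have n: "?n k > 0" for k using ys(2)[of k] by simp
    define a where "a k z = (F (ys k) z - F x z) / ?n k" for k z
    define b where "b k z = blinfun_apply (G x z) (ys k - x) / ?n k" for k z
    let ?u = "\<lambda>k z. a k z - b k z"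
    have ia: "integrable M (a k)" and ib: "integrable M (b k)" for k
      unfolding a_def b_def by (auto intro!: F_integrable G_apply_integrable ys x)
    have lim0: "(\<lambda>k. \<integral>z. \<bar>?u k z\<bar> \<partial>M) \<longlonglongrightarrow> 0"
    proof (rule tendsto_expectation_zero)
      show "?u k \<in> borel_measurable M" for k using ia ib by (intro borel_measurable_diff) auto
      show "AE z in M. (\<lambda>k. ?u k z) \<longlonglongrightarrow> 0"
        using G_derivative
      proof eventually_elim
        case (elim z)
        with x have "((\<lambda>x. F x z) has_derivative blinfun_apply (G x z)) (at x within X)" by blast
        then have "((\<lambda>y. (1 / norm (y - x)) *\<^sub>R (F y z - (F x z + blinfun_apply (G x z) (y - x)))) \<longlongrightarrow> 0) (at x within X)"
          unfolding has_derivative_within by blast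
        then have "(\<lambda>k. (1 / ?n k) *\<^sub>R (F (ys k) z - (F x z + blinfun_apply (G x z) (ys k - x)))) \<longlonglongrightarrow> 0"
          unfolding tendsto_at_iff_sequentially comp_def using ys lim by auto
        then show ?case by (simp add: a_def b_def field_simps diff_divide_distrib add_divide_distrib)
      qed
      fix k
      have sq: "(\<integral>\<^sup>+z. ennreal ((u z / ?n k)\<^sup>2) \<partial>M) \<le> ennreal (V\<^sup>2)"
        if [measurable]: "u \<in> borel_measurable M" and "(\<integral>\<^sup>+z. ennreal ((u z)\<^sup>2) \<partial>M) \<le> ennreal ((?n k)\<^sup>2 * V\<^sup>2)" for u
      proof -
        have "(\<integral>\<^sup>+z. ennreal ((u z / ?n k)\<^sup>2) \<partial>M) = (\<integral>\<^sup>+z. ennreal (1 / (?n k)\<^sup>2) * ennreal ((u z)\<^sup>2) \<partial>M)"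
          by (intro nn_integral_cong) (simp add: power_divide flip: ennreal_mult)
        also have "\<dots> = ennreal (1 / (?n k)\<^sup>2) * (\<integral>\<^sup>+z. ennreal ((u z)\<^sup>2) \<partial>M)"
          by (intro nn_integral_cmult) auto
        also have "\<dots> \<le> ennreal (1 / (?n k)\<^sup>2) * ennreal ((?n k)\<^sup>2 * V\<^sup>2)"
          by (intro mult_left_mono that) auto
        also have "\<dots> = ennreal (V\<^sup>2)" using n[of k] by (simp flip: ennreal_mult)
        finally show ?thesis .
      qed
      show "(\<integral>\<^sup>+z. ennreal ((?u k z)\<^sup>2) \<partial>M) \<le> ennreal (4 * V\<^sup>2)"
      proof (rule nn_integral_square_sum_le)
        show "(\<integral>\<^sup>+z. ennreal ((a k z)\<^sup>2) \<partial>M) \<le> ennreal (V\<^sup>2)" unfolding a_def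
          by (rule sq[OF _ increment_square[OF x ys(1)]])
             (intro borel_measurable_diff borel_measurable_integrable F_integrable x ys)
        show "(\<integral>\<^sup>+z. ennreal ((b k z)\<^sup>2) \<partial>M) \<le> ennreal (V\<^sup>2)" unfolding b_def
          by (rule sq[OF G_apply_measurable[OF x] G_apply_square[OF x order_refl]])
      qed (use ia ib in auto)
    qed
    have "(1 / ?n k) *\<^sub>R (f (ys k) - (f x + mean_gradient x (ys k - x))) = (\<integral>z. ?u k z \<partial>M)" for k
    proof -
      have "(\<integral>z. a k z \<partial>M) = (f (ys k) - f x) / ?n k"
        unfolding a_def objective_def using F_integrable[OF x] F_integrable[OF ys(1)] by simp
      moreover have "(\<integral>z. b k z \<partial>M) = mean_gradient x (ys k - x) / ?n k"
        unfolding b_def mean_gradient_def by simp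
      ultimately show ?thesis using ia ib by (simp add: diff_divide_distrib add_divide_distrib)
    qed
    moreover have "\<bar>\<integral>z. ?u k z \<partial>M\<bar> \<le> (\<integral>z. \<bar>?u k z\<bar> \<partial>M)" for k by (rule integral_abs_bound)
    ultimately have "\<bar>(1 / ?n k) *\<^sub>R (f (ys k) - (f x + mean_gradient x (ys k - x)))\<bar> \<le> (\<integral>z. \<bar>?u k z\<bar> \<partial>M)" for k
      by simp
    then have "(\<lambda>k. \<bar>(1 / ?n k) *\<^sub>R (f (ys k) - (f x + mean_gradient x (ys k - x)))\<bar>) \<longlonglongrightarrow> 0"
      by (intro real_tendsto_sandwich[OF _ _ tendsto_const lim0]) (auto intro!: always_eventually)
    then show "(\<lambda>k. (1 / ?n k) *\<^sub>R (f (ys k) - (f x + mean_gradient x (ys k - x)))) \<longlonglongrightarrow> 0"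
      by (rule tendsto_rabs_zero_iff[THEN iffD1])
  qed
qed

text \<open>\<open>gradient_on\<close> rests on an arbitrarily chosen derivative, so agreement with
  \<open>mean_gradient\<close> is claimed only on differences of feasible points.\<close>

lemma gradient_on_objective:
  assumes x: "x \<in> X" and p: "p \<in> X"
  shows "blinfun_apply (gradient_on X f x) (x - p) = mean_gradient x (x - p)"
proof -
  note d = objective_has_derivative[OF x]
  have d': "(f has_derivative frechet_derivative f (at x within X)) (at x within X)"
    using d frechet_derivative_works differentiable_def by blast
  then have "blinfun_apply (gradient_on X f x) = frechet_derivative f (at x within X)"
    unfolding gradient_on_def by (intro bounded_linear_Blinfun_apply has_derivative_bounded_linear)
  moreover have "frechet_derivative f (at x within X) (p - x) = mean_gradient x (p - x)"
    by (rule has_derivative_within_convex_unique[OF convex_X x p d' d])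
  ultimately show ?thesis
    using linear_neg[OF bounded_linear.linear[OF mean_gradient_bounded_linear[OF x]], of "p - x"]
      blinfun.minus_right[of "gradient_on X f x" "p - x"] by simp
qed

end

section \<open>Convergence of stochastic mirror descent\<close>

text \<open>Otherwise \<open>a\<close> stays above \<open>e\<close> from \<open>m\<close> on, and
  comparison makes \<open>g\<close> summable, against its divergence.\<close>

lemma frequently_small_of_summable:
  fixes g a :: "nat \<Rightarrow> real"
  assumes g: "\<And>n. g n > 0" and div: "filterlim (\<lambda>n. \<Sum>k<n. g k) at_top sequentially"
    and sum: "summable (\<lambda>n. g n * a n)" and e: "e > 0"
  shows "\<exists>n\<ge>m. a n < e"
proof (rule ccontr)
  assume "\<not> (\<exists>n\<ge>m. a n < e)"
  then have a: "e \<le> a n" if "n \<ge> m" for n using that by (auto simp: not_less)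
  have "norm (g n * e) \<le> g n * a n" if "n \<ge> m" for n
    using a[OF that] g[of n] e by (simp add: abs_mult)
  then have "summable (\<lambda>n. g n * e)" by (rule summable_comparison_test'[OF sum])
  then have "summable g" using e by (simp add: summable_cmult_iff mult.commute)
  then have "(\<lambda>n. \<Sum>k<n. g k) \<longlonglongrightarrow> suminf g" by (rule summable_LIMSEQ)
  with div show False
    using not_tendsto_and_filterlim_at_infinity[OF _ _ filterlim_at_top_imp_at_infinity[OF div]] by auto
qed

text \<open>A maximal independent set of differences is finite in finite dimension. Applied to the
  solutions, it leaves only finitely many null sets to discard.\<close>

lemma finite_affine_generators:
  fixes A :: "'v::real_vector set"
  assumes "finite_dimensional TYPE('v)"
  obtains P where "finite P" "P \<subseteq> A" "\<And>q. q \<in> A \<Longrightarrow> q - p \<in> span ((\<lambda>x. x - p) ` P)"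
proof -
  obtain B :: "'v set" where B: "finite B" "span B = UNIV"
    using assms unfolding finite_dimensional_def by auto
  obtain T where T: "T \<subseteq> (\<lambda>x. x - p) ` A" "independent T" "(\<lambda>x. x - p) ` A \<subseteq> span T"
    by (rule maximal_independent_subset)
  have "finite T" using independent_span_bound[OF B(1) T(2)] B(2) by simp
  then obtain P where "P \<subseteq> A" "finite P" "T = (\<lambda>x. x - p) ` P"
    using finite_subset_image[OF _ T(1)] by blast
  then show thesis using that T(3) by blast
qed

lemma smd_dual_cong:
  assumes "\<And>n x. DF x (w n) = DF' x (w n)"
  shows "smd_dual X h DF \<gamma> y w n = smd_dual X h DF' \<gamma> y w n"
  by (induction n) (simp_all add: assms)

text \<open>Iterate \<open>n\<close> has consumed the samples \<open>0\<close> to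
  \<open>n - 1\<close>, so sample \<open>n\<close> is fresh when the gradient is evaluated
  there.\<close>

lemma smd_dual_depends_below: "depends_below n (\<lambda>w. smd_dual X h DF \<gamma> y w n)"
proof (induction n)
  case 0 then show ?case by (simp add: depends_below_def)
next
  case (Suc n)
  show ?case unfolding depends_below_def
  proof (intro allI impI)
    fix w w' :: "nat \<Rightarrow> 'a" assume *: "\<forall>i<Suc n. w i = w' i"
    then have "smd_dual X h DF \<gamma> y w n = smd_dual X h DF \<gamma> y w' n"
      using Suc[unfolded depends_below_def, rule_format, of w w'] by simp
    then show "smd_dual X h DF \<gamma> y w (Suc n) = smd_dual X h DF \<gamma> y w' (Suc n)"
      using * by simp
  qed
qed

section \<open>Mirror descent driven by the coordinates of the product space\<close>

locale smd_convergence = stochastic_gradient M X F G V + mirror X h K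
  for M :: "'w measure" and X :: "'v::real_normed_vector set" and F G V h K +
  fixes \<gamma> :: "nat \<Rightarrow> real" and y1 :: "'v \<Rightarrow>\<^sub>L real"
  assumes fin_dim: "finite_dimensional TYPE('v)"
    and coherent: "variationally_coherent X (objective M F)"
    and reciprocity: "\<And>p (y :: nat \<Rightarrow> 'v \<Rightarrow>\<^sub>L real). p \<in> X \<Longrightarrow>
           (\<lambda>n. mirror_map X h (y n)) \<longlonglongrightarrow> p \<Longrightarrow> (\<lambda>n. fenchel_coupling X h p (y n)) \<longlonglongrightarrow> 0"
    and \<gamma>_pos: "\<And>n. \<gamma> n > 0" and \<gamma>_square: "summable (\<lambda>n. (\<gamma> n)\<^sup>2)"
    and \<gamma>_diverges: "filterlim (\<lambda>n. \<Sum>k<n. \<gamma> k) at_top sequentially"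
begin

abbreviation "S \<equiv> Pi\<^sub>M (UNIV :: nat set) (\<lambda>_. M)"
abbreviation "Y w n \<equiv> smd_dual X h G \<gamma> y1 w n"
abbreviation "x w n \<equiv> mirror_map X h (smd_dual X h G \<gamma> y1 w n)"
abbreviation "solutions \<equiv> minimizers X (objective M F)"

sublocale S: prob_space S
  by (intro prob_space_PiM prob_space_axioms)

lemma solutions_subset: "solutions \<subseteq> X"
  by (auto simp: minimizers_def is_arg_min_def)

lemma x_update: "x (w(n := z)) n = x w n"
  using depends_below_upd[OF smd_dual_depends_below order_refl, of X h G \<gamma> y1 w n z] by simp

text \<open>The induction alternates: evaluations of \<open>Y w n\<close> give measurability of the
  primal iterate, and the Caratheodory property of \<open>G\<close> then gives the next
  evaluations.\<close>

lemma dual_measurable: "q \<in> X \<Longrightarrow> (\<lambda>w. blinfun_apply (Y w n) q) \<in> borel_measurable S"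
proof (induction n arbitrary: q)
  case 0 then show ?case by simp
next
  case (Suc n)
  have [measurable]: "(\<lambda>w. blinfun_apply (G (x w n) (w n)) q) \<in> borel_measurable S"
    by (rule borel_measurable_Caratheodory[OF compact_X mirror_map_measurable[OF Suc.IH] mirror_map_in,
          where M=M and w="\<lambda>w. w n" and G="\<lambda>x z. blinfun_apply (G x z) q"])
       (auto intro: G_apply_measurable intro!: continuous_intros G_continuous)
  show ?case using Suc by (simp add: blinfun.bilinear_simps)
qed

lemma x_measurable: "(\<lambda>w. x w n) \<in> borel_measurable S"
  by (rule mirror_map_measurable[OF dual_measurable])

lemma gradient_pairing_measurable:
  "(\<lambda>w. blinfun_apply (G (x w n) (w n)) (x w n - p)) \<in> borel_measurable S"
proof (rule borel_measurable_Caratheodory[OF compact_X x_measurable mirror_map_in, where M=M and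
      w="\<lambda>w. w n" and G="\<lambda>x z. blinfun_apply (G x z) (x - p)"])
  fix z assume "z \<in> space M"
  then show "continuous_on X (\<lambda>x. blinfun_apply (G x z) (x - p))"
    by (intro continuous_intros G_continuous)
qed (auto intro: G_apply_measurable)

lemma gradient_norm_measurable: "(\<lambda>w. norm (G (x w n) (w n))) \<in> borel_measurable S"
proof (rule borel_measurable_Caratheodory[OF compact_X x_measurable mirror_map_in, where M=M and
      w="\<lambda>w. w n" and G="\<lambda>x z. norm (G x z)"])
  fix z assume "z \<in> space M"
  then show "continuous_on X (\<lambda>x. norm (G x z))"
    by (intro continuous_intros G_continuous)
qed (auto intro: G_norm_measurable)

lemma mean_gradient_measurable: "(\<lambda>w. mean_gradient (x w n) (x w n - p)) \<in> borel_measurable S"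
proof (rule borel_measurable_Caratheodory[OF compact_X x_measurable mirror_map_in, where M=M and
      w="\<lambda>w. w n" and G="\<lambda>x z. mean_gradient x (x - p)"])
  show "continuous_on X (\<lambda>x. mean_gradient x (x - p))"
    unfolding continuous_on_sequentially comp_def
    by (auto intro!: mean_gradient_tendsto tendsto_intros)
qed auto

lemma mean_gradient_nonneg:
  assumes p: "p \<in> solutions" and q: "q \<in> X"
  shows "0 \<le> mean_gradient q (q - p)"
proof -
  have "0 \<le> blinfun_apply (gradient_on X f q) (q - p)"
    using coherent p q unfolding variationally_coherent_def by blast
  then show ?thesis
    using gradient_on_objective[OF q, of p] p solutions_subset by auto
qed

text \<open>Resampling coordinate \<open>n\<close> freezes the iterate, so each term has mean at
  most \<open>(\<gamma> n)\<^sup>2 * V\<^sup>2\<close>. A series of nonnegative terms with finite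
  expectation is almost surely finite.\<close>

lemma AE_square_summable: "AE w in S. summable (\<lambda>n. (\<gamma> n)\<^sup>2 * (norm (G (x w n) (w n)))\<^sup>2)"
proof -
  let ?u = "\<lambda>n w. (\<gamma> n)\<^sup>2 * (norm (G (x w n) (w n)))\<^sup>2"
  have [measurable]: "?u n \<in> borel_measurable S" for n
    using gradient_norm_measurable[of n] by measurable
  have "(\<integral>\<^sup>+w. ennreal (?u n w) \<partial>S) \<le> ennreal ((\<gamma> n)\<^sup>2 * V\<^sup>2)" for n
  proof -
    have "(\<integral>\<^sup>+w. ennreal (?u n w) \<partial>S) = (\<integral>\<^sup>+w. \<integral>\<^sup>+z. ennreal (?u n (w(n := z))) \<partial>M \<partial>S)"
      by (rule nn_integral_PiM_resample[OF prob_space_axioms]) measurable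
    also have "\<dots> \<le> (\<integral>\<^sup>+w. ennreal ((\<gamma> n)\<^sup>2 * V\<^sup>2) \<partial>S)"
    proof (rule nn_integral_mono)
      fix w
      have "(\<integral>\<^sup>+z. ennreal (?u n (w(n := z))) \<partial>M) = (\<integral>\<^sup>+z. ennreal ((\<gamma> n)\<^sup>2) * ennreal ((norm (G (x w n) z))\<^sup>2) \<partial>M)"
        by (simp add: x_update ennreal_mult)
      also have "\<dots> = ennreal ((\<gamma> n)\<^sup>2) * (\<integral>\<^sup>+z. ennreal ((norm (G (x w n) z))\<^sup>2) \<partial>M)"
        using G_norm_measurable[OF mirror_map_in] by (intro nn_integral_cmult) auto
      also have "\<dots> \<le> ennreal ((\<gamma> n)\<^sup>2) * ennreal (V\<^sup>2)"
        by (intro mult_left_mono G_square mirror_map_in) auto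
      finally show "(\<integral>\<^sup>+z. ennreal (?u n (w(n := z))) \<partial>M) \<le> ennreal ((\<gamma> n)\<^sup>2 * V\<^sup>2)"
        by (simp add: ennreal_mult)
    qed
    also have "\<dots> = ennreal ((\<gamma> n)\<^sup>2 * V\<^sup>2)" by (simp add: S.emeasure_space_1)
    finally show ?thesis .
  qed
  then have "(\<integral>\<^sup>+w. (\<Sum>n. ennreal (?u n w)) \<partial>S) \<le> (\<Sum>n. ennreal ((\<gamma> n)\<^sup>2 * V\<^sup>2))"
    by (subst nn_integral_suminf) (auto intro!: suminf_le)
  also have "\<dots> < \<infinity>"
    using summable_mult2[OF \<gamma>_square, of "V\<^sup>2"] by (subst suminf_ennreal2) auto
  finally have "AE w in S. (\<Sum>n. ennreal (?u n w)) \<noteq> \<infinity>"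
    by (intro nn_integral_PInf_AE) auto
  then show ?thesis
    by eventually_elim (rule summable_suminf_not_top, auto)
qed

definition noise :: "'v \<Rightarrow> nat \<Rightarrow> (nat \<Rightarrow> 'w) \<Rightarrow> real" where
  "noise p n w = \<gamma> n * (blinfun_apply (G (x w n) (w n)) (x w n - p) - mean_gradient (x w n) (x w n - p))"

lemma AE_noise_summable:
  assumes p: "p \<in> X"
  shows "AE w in S. summable (\<lambda>n. noise p n w)"
proof -
  obtain R where R: "\<And>q. q \<in> X \<Longrightarrow> norm (q - p) \<le> R"
    using compact_imp_bounded[OF compact_X] p by (metis bounded_any_center dist_commute dist_norm)
  have "martingale_differences M (noise p) (\<lambda>n. (\<gamma> n)\<^sup>2 * (R\<^sup>2 * V\<^sup>2))"
  proof (intro martingale_differences.intro martingale_differences_axioms.intro prob_space_axioms)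
    show meas: "noise p n \<in> borel_measurable S" for n
      unfolding noise_def[abs_def]
      by (intro borel_measurable_times borel_measurable_diff borel_measurable_const
          gradient_pairing_measurable mean_gradient_measurable)
    show "depends_below (Suc n) (noise p n)" for n
      unfolding depends_below_def noise_def
    proof (intro allI impI)
      fix w w' :: "nat \<Rightarrow> 'w" assume *: "\<forall>i<Suc n. w i = w' i"
      then have "Y w n = Y w' n"
        using smd_dual_depends_below[unfolded depends_below_def, rule_format, of n w w' X h G \<gamma> y1] by simp
      then show "\<gamma> n * (blinfun_apply (G (x w n) (w n)) (x w n - p) - mean_gradient (x w n) (x w n - p)) =
        \<gamma> n * (blinfun_apply (G (x w' n) (w' n)) (x w' n - p) - mean_gradient (x w' n) (x w' n - p))"
        using * by simp
    qed
    fix n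
    have resample: "noise p n (w(n := z)) =
        \<gamma> n * (blinfun_apply (G (x w n) z) (x w n - p) - mean_gradient (x w n) (x w n - p))" for w z
      by (simp add: noise_def x_update)
    show "(\<integral>z. noise p n (w(n := z)) \<partial>M) = 0" for w
      unfolding resample using G_apply_integrable[OF mirror_map_in]
      by (simp add: mean_gradient_def prob_space)
    have "(\<integral>\<^sup>+w. ennreal ((noise p n w)\<^sup>2) \<partial>S) = (\<integral>\<^sup>+w. \<integral>\<^sup>+z. ennreal ((noise p n (w(n := z)))\<^sup>2) \<partial>M \<partial>S)"
      using meas[of n] by (intro nn_integral_PiM_resample[OF prob_space_axioms]) measurable
    also have "\<dots> \<le> (\<integral>\<^sup>+w. ennreal ((\<gamma> n)\<^sup>2 * (R\<^sup>2 * V\<^sup>2)) \<partial>S)"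
    proof (rule nn_integral_mono)
      fix w
      let ?q = "x w n"
      let ?u = "\<lambda>z. blinfun_apply (G ?q z) (?q - p)"
      have q: "?q \<in> X" by (rule mirror_map_in)
      note u = G_apply_measurable[OF q, of "?q - p"]
      note sq = G_apply_square[OF q R[OF q]]
      note int = integrable_of_second_moment[OF u sq]
      \<comment> \<open>With the iterate frozen, the noise is a centered variable, and a variance is
        at most the second moment.\<close>
      have "(\<integral>\<^sup>+z. ennreal ((?u z - expectation ?u)\<^sup>2) \<partial>M) = ennreal (variance ?u)"
      proof (rule nn_integral_eq_integral)
        show "integrable M (\<lambda>z. (?u z - expectation ?u)\<^sup>2)"
          using int by (simp add: power2_diff)
      qed simp
      also have "\<dots> \<le> ennreal (expectation (\<lambda>z. (?u z)\<^sup>2))"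
        by (rule ennreal_leI, subst variance_eq[OF int(2,1)]) (simp only: diff_le_eq le_add_same_cancel1 zero_le_power2)
      also have "\<dots> = (\<integral>\<^sup>+z. ennreal ((?u z)\<^sup>2) \<partial>M)"
        using int(1) by (rule nn_integral_eq_integral[symmetric]) simp
      also have "\<dots> \<le> ennreal (R\<^sup>2 * V\<^sup>2)" by (rule sq)
      finally have var: "(\<integral>\<^sup>+z. ennreal ((?u z - expectation ?u)\<^sup>2) \<partial>M) \<le> ennreal (R\<^sup>2 * V\<^sup>2)" .
      have "(\<integral>\<^sup>+z. ennreal ((noise p n (w(n := z)))\<^sup>2) \<partial>M)
          = (\<integral>\<^sup>+z. ennreal ((\<gamma> n)\<^sup>2) * ennreal ((?u z - expectation ?u)\<^sup>2) \<partial>M)"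
        by (simp add: resample mean_gradient_def power_mult_distrib ennreal_mult)
      also have "\<dots> = ennreal ((\<gamma> n)\<^sup>2) * (\<integral>\<^sup>+z. ennreal ((?u z - expectation ?u)\<^sup>2) \<partial>M)"
        using u by (intro nn_integral_cmult) auto
      also have "\<dots> \<le> ennreal ((\<gamma> n)\<^sup>2) * ennreal (R\<^sup>2 * V\<^sup>2)"
        by (intro mult_left_mono var) simp
      finally show "(\<integral>\<^sup>+z. ennreal ((noise p n (w(n := z)))\<^sup>2) \<partial>M) \<le> ennreal ((\<gamma> n)\<^sup>2 * (R\<^sup>2 * V\<^sup>2))"
        by (simp add: ennreal_mult)
    qed
    also have "\<dots> = ennreal ((\<gamma> n)\<^sup>2 * (R\<^sup>2 * V\<^sup>2))" by (simp add: S.emeasure_space_1)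
    finally show "(\<integral>\<^sup>+w. ennreal ((noise p n w)\<^sup>2) \<partial>S) \<le> ennreal ((\<gamma> n)\<^sup>2 * (R\<^sup>2 * V\<^sup>2))" .
  qed (auto intro: summable_mult2 \<gamma>_square)
  then show ?thesis by (rule martingale_differences.AE_summable)
qed

lemma AE_fenchel_convergent:
  assumes p: "p \<in> solutions"
  shows "AE w in S. convergent (\<lambda>n. \<Phi> p (Y w n)) \<and> summable (\<lambda>n. \<gamma> n * mean_gradient (x w n) (x w n - p))"
proof -
  have pX: "p \<in> X" using p solutions_subset by blast
  show ?thesis
    using AE_square_summable AE_noise_summable[OF pX]
  proof eventually_elim
    case (elim w)
    \<comment> \<open>The sampled pairing splits into its mean, which is the drift, and its error,
      which is \<open>noise p n w\<close>.\<close>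
    have step: "\<Phi> p (Y w (Suc n)) \<le> \<Phi> p (Y w n) - \<gamma> n * mean_gradient (x w n) (x w n - p) - noise p n w
        + (\<gamma> n)\<^sup>2 * (norm (G (x w n) (w n)))\<^sup>2 / (2 * K)" for n
      using fenchel_coupling_step[of p "Y w n" "- (\<gamma> n *\<^sub>R G (x w n) (w n))"]
      by (simp add: blinfun.bilinear_simps noise_def power_mult_distrib algebra_simps)
    have "0 \<le> \<gamma> n * mean_gradient (x w n) (x w n - p)" for n
      using mean_gradient_nonneg[OF p mirror_map_in] \<gamma>_pos[of n] by simp
    with almost_decreasing_convergent[OF step fenchel_coupling_nonneg[OF pX] _ elim(2) summable_divide[OF elim(1)]]
    show ?case by blast
  qed
qed

text \<open>The exceptional null set must not depend on the limit point, which is random. Since \<open>\<Phi> p y\<close> is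
  affine in \<open>p\<close> up to the term \<open>h p\<close>, convergence of \<open>\<Phi> p (Y w n)\<close> for finitely many \<open>p\<close> that affinely
  span the solution set gives convergence for all solutions.\<close>

lemma AE_fenchel_convergent_all: "AE w in S. \<forall>q\<in>solutions. convergent (\<lambda>n. \<Phi> q (Y w n))"
proof (cases "solutions = {}")
  case False
  then obtain p where p: "p \<in> solutions" by blast
  obtain P where P: "finite P" "P \<subseteq> solutions" "\<And>q. q \<in> solutions \<Longrightarrow> q - p \<in> span ((\<lambda>x. x - p) ` P)"
    using finite_affine_generators[OF fin_dim] by metis
  have "AE w in S. \<forall>q\<in>insert p P. convergent (\<lambda>n. \<Phi> q (Y w n))"
  proof (rule AE_finite_allI)
    fix q assume "q \<in> insert p P"
    then have "q \<in> solutions" using p P(2) by auto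
    from AE_fenchel_convergent[OF this] show "AE w in S. convergent (\<lambda>n. \<Phi> q (Y w n))"
      by eventually_elim simp
  qed (use P(1) in simp)
  then show ?thesis
  proof eventually_elim
    case (elim w)
    \<comment> \<open>The directions in which the dual iterates converge form a subspace, so
      generators suffice.\<close>
    let ?L = "{v. convergent (\<lambda>n. blinfun_apply (Y w n) v)}"
    have diff: "blinfun_apply (Y w n) (q - p) = h q - h p + (\<Phi> p (Y w n) - \<Phi> q (Y w n))" for n q
      by (simp add: fenchel_coupling_def blinfun.bilinear_simps)
    have "subspace ?L"
      by (auto simp: subspace_def blinfun.bilinear_simps convergent_const intro: convergent_add convergent_mult)
    moreover have "(\<lambda>x. x - p) ` P \<subseteq> ?L"
      using elim by (auto simp: diff convergent_add convergent_diff convergent_const)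
    ultimately have L: "span ((\<lambda>x. x - p) ` P) \<subseteq> ?L" by (rule span_minimal[rotated])
    show ?case
    proof
      fix q assume "q \<in> solutions"
      with P(3) L have "convergent (\<lambda>n. blinfun_apply (Y w n) (q - p))" by blast
      then have "convergent (\<lambda>n. h q - h p + \<Phi> p (Y w n) - blinfun_apply (Y w n) (q - p))"
        using elim by (intro convergent_diff convergent_add convergent_const) auto
      then show "convergent (\<lambda>n. \<Phi> q (Y w n))" by (simp add: diff)
    qed
  qed
qed simp

lemma AE_converges: "AE w in S. \<exists>q\<in>solutions. (\<lambda>n. x w n) \<longlonglongrightarrow> q"
proof -
  obtain p where p: "p \<in> solutions"
    and sep: "\<And>q. q \<in> X \<Longrightarrow> blinfun_apply (gradient_on X f q) (q - p) = 0 \<Longrightarrow> q \<in> solutions"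
    using coherent unfolding variationally_coherent_def by blast
  have pX: "p \<in> X" using p solutions_subset by blast
  show ?thesis
    using AE_fenchel_convergent[OF p] AE_fenchel_convergent_all
  proof eventually_elim
    case (elim w)
    let ?a = "\<lambda>n. mean_gradient (x w n) (x w n - p)"
    \<comment> \<open>Using \<open>k\<close> both as starting index and in the tolerance gives
      indices tending to infinity along which the pairing vanishes.\<close>
    have "\<exists>n\<ge>k. ?a n < 1 / real (Suc k)" for k
      using elim(1) by (intro frequently_small_of_summable[OF \<gamma>_pos \<gamma>_diverges]) auto
    then obtain r where r: "\<And>k. r k \<ge> k" "\<And>k. ?a (r k) < 1 / real (Suc k)" by metis
    obtain q s where q: "q \<in> X" "strict_mono s" "(\<lambda>k. x w (r (s k))) \<longlonglongrightarrow> q"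
      using compact_X[unfolded compact_def, rule_format, of "\<lambda>k. x w (r k)"] mirror_map_in
      by (auto simp: comp_def)
    \<comment> \<open>\<open>r\<close> may fail to be monotone; \<open>r k \<ge> k\<close> already
      sends the composed indices to infinity.\<close>
    have rs: "filterlim (\<lambda>k. r (s k)) sequentially sequentially"
      by (rule filterlim_at_top_mono[OF filterlim_ident])
         (auto intro!: always_eventually order_trans[OF seq_suble[OF q(2)] r(1)])
    have "(\<lambda>k. ?a (r (s k))) \<longlonglongrightarrow> 0"
    proof (rule real_tendsto_sandwich[OF _ _ tendsto_const])
      show "(\<lambda>k. 1 / real (Suc (s k))) \<longlonglongrightarrow> 0"
        using LIMSEQ_subseq_LIMSEQ[OF LIMSEQ_Suc[OF lim_1_over_n] q(2)] by (simp add: comp_def)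
      show "\<forall>\<^sub>F k in sequentially. ?a (r (s k)) \<le> 1 / real (Suc (s k))"
        using r(2) by (auto intro!: always_eventually less_imp_le)
    qed (auto intro!: always_eventually mean_gradient_nonneg p mirror_map_in)
    moreover have "(\<lambda>k. ?a (r (s k))) \<longlonglongrightarrow> mean_gradient q (q - p)"
      using q by (intro mean_gradient_tendsto tendsto_intros mirror_map_in) auto
    ultimately have "mean_gradient q (q - p) = 0" using LIMSEQ_unique by blast
    then have sol: "q \<in> solutions"
      using sep q(1) gradient_on_objective[OF q(1) pX] by simp
    \<comment> \<open>The point \<open>q\<close> depends on \<open>w\<close>, which is why the null
      set had to serve all solutions at once.\<close>
    with elim(2) obtain l where l: "(\<lambda>n. \<Phi> q (Y w n)) \<longlonglongrightarrow> l" by (auto simp: convergent_def)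
    have "(\<lambda>k. \<Phi> q (Y w (r (s k)))) \<longlonglongrightarrow> 0" by (rule reciprocity[OF q(1,3)])
    with filterlim_compose[OF l rs] have "l = 0" using LIMSEQ_unique by blast
    have lim: "(\<lambda>n. sqrt (2 / K * \<Phi> q (Y w n))) \<longlonglongrightarrow> 0"
      using tendsto_real_sqrt[OF tendsto_mult_left[OF l, of "2 / K"]] \<open>l = 0\<close> by simp
    have "norm (x w n - q) \<le> sqrt (2 / K * \<Phi> q (Y w n))" for n
      using fenchel_coupling_ge[OF q(1), of "Y w n"] K_pos by (intro real_le_rsqrt) (simp add: field_simps)
    then have "(\<lambda>n. norm (x w n - q)) \<longlonglongrightarrow> 0"
      by (intro real_tendsto_sandwich[OF _ _ tendsto_const lim]) (auto intro!: always_eventually)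
    then have "(\<lambda>n. x w n) \<longlonglongrightarrow> q"
      using Lim_null tendsto_norm_zero_iff by blast
    with sol show ?case by blast
  qed
qed

end

section \<open>Transfer to arbitrary independent samples\<close>

theorem theorem4p1:
  fixes X :: "'v::real_normed_vector set"
    and M :: "'w measure"
    and F :: "'v \<Rightarrow> 'w \<Rightarrow> real"
    and DF :: "'v \<Rightarrow> 'w \<Rightarrow> 'v \<Rightarrow>\<^sub>L real"
    and V :: real
    and h :: "'v \<Rightarrow> real"
    and \<gamma> :: "nat \<Rightarrow> real"
    and y1 :: "'v \<Rightarrow>\<^sub>L real"
    and N :: "'s measure"
    and W :: "nat \<Rightarrow> 's \<Rightarrow> 'w"
  assumes "finite_dimensional TYPE('v)"
    and "X \<noteq> {}" and "compact X" and "convex X"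
    and "prob_space M" and "complete_measure M"
    and "\<And>x. x \<in> X \<Longrightarrow> integrable M (F x)"
    and "\<And>x. x \<in> X \<Longrightarrow> DF x \<in> borel_measurable M"
    and coherent: "variationally_coherent X (objective M F)"
    and smooth: "AE \<omega> in M. C1_on X (\<lambda>x. F x \<omega>) (\<lambda>x. DF x \<omega>)"
    and "V \<ge> 0"
    and second_moment: "\<And>x. x \<in> X \<Longrightarrow> integrable M (\<lambda>\<omega>. (norm (DF x \<omega>))\<^sup>2) \<and>
                                  (\<integral>\<omega>. (norm (DF x \<omega>))\<^sup>2 \<partial>M) \<le> V\<^sup>2"
    and "regularizer X h"
    and reciprocity: "\<And>p (y :: nat \<Rightarrow> 'v \<Rightarrow>\<^sub>L real). p \<in> X \<Longrightarrow>
           (\<lambda>n. mirror_map X h (y n)) \<longlonglongrightarrow> p \<Longrightarrow> (\<lambda>n. fenchel_coupling X h p (y n)) \<longlonglongrightarrow> 0"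
    and "iid_samples N M W"
    and "\<And>n. \<gamma> n > 0" and "summable (\<lambda>n. (\<gamma> n)\<^sup>2)"
    and "filterlim (\<lambda>n. \<Sum>k<n. \<gamma> k) at_top sequentially"
  shows "AE s in N. \<exists>x\<in>minimizers X (objective M F).
           smd X h DF \<gamma> y1 (\<lambda>n. W n s) \<longlonglongrightarrow> x"
proof -
  obtain Z where Z: "Z \<in> null_sets M"
    "{\<omega> \<in> space M. \<not> C1_on X (\<lambda>x. F x \<omega>) (\<lambda>x. DF x \<omega>)} \<subseteq> Z"
    using smooth unfolding eventually_ae_filter by blast
  have C1: "C1_on X (\<lambda>x. F x \<omega>) (\<lambda>x. DF x \<omega>)" if "\<omega> \<in> space M - Z" for \<omega>
    using that Z(2) by blast
  have AE_Z: "AE \<omega> in M. \<omega> \<in> space M - Z"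
    using AE_not_in[OF Z(1)] AE_space[of M] by eventually_elim simp
  \<comment> \<open>Setting the gradient to \<open>0\<close> on the null set \<open>Z\<close> makes
    it continuous in its first argument at every sample point.\<close>
  define G where "G x \<omega> = (if \<omega> \<in> space M - Z then DF x \<omega> else 0)" for x \<omega>
  obtain K where K: "K > 0" "strongly_convex_on X K h" and cont_h: "continuous_on X h"
    using \<open>regularizer X h\<close> unfolding regularizer_def by blast
  interpret smd_convergence M X F G V h K \<gamma> y1
  proof (intro smd_convergence.intro smd_convergence_axioms.intro stochastic_gradient.intro
      stochastic_gradient_axioms.intro mirror.intro)
    fix x assume x: "x \<in> X"
    show "G x \<in> borel_measurable M"
      unfolding G_def[abs_def] using null_setsD2[OF Z(1)]
      by (intro measurable_If_set assms(8)[OF x] measurable_const) auto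
    have "(\<integral>\<^sup>+z. ennreal ((norm (G x z))\<^sup>2) \<partial>M) = (\<integral>\<^sup>+z. ennreal ((norm (DF x z))\<^sup>2) \<partial>M)"
      by (intro nn_integral_cong_AE, use AE_Z in eventually_elim) (simp add: G_def)
    also have "\<dots> = ennreal (\<integral>z. (norm (DF x z))\<^sup>2 \<partial>M)"
      using second_moment[OF x] by (intro nn_integral_eq_integral) auto
    finally show "(\<integral>\<^sup>+z. ennreal ((norm (G x z))\<^sup>2) \<partial>M) \<le> ennreal (V\<^sup>2)"
      using second_moment[OF x] by (simp add: ennreal_leI)
  next
    fix z assume "z \<in> space M"
    show "continuous_on X (\<lambda>x. G x z)"
      using C1[of z] by (cases "z \<in> space M - Z") (auto simp: G_def C1_on_def)
  next
    show "AE z in M. \<forall>x\<in>X. ((\<lambda>x. F x z) has_derivative blinfun_apply (G x z)) (at x within X)"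
      using AE_Z by eventually_elim (use C1 in \<open>auto simp: G_def C1_on_def\<close>)
  qed (use assms K cont_h in auto)
  \<comment> \<open>Almost surely no sample hits \<open>Z\<close>, so the recursions driven by
    \<open>DF\<close> and by \<open>G\<close> coincide.\<close>
  have "AE w in S. \<forall>n. w n \<in> space M - Z"
    unfolding AE_all_countable
    by (intro allI AE_PiM_component AE_Z assms(5)) auto
  then have conv: "AE w in S. \<exists>q\<in>solutions. smd X h DF \<gamma> y1 w \<longlonglongrightarrow> q"
    using AE_converges
  proof eventually_elim
    case (elim w)
    have "smd_dual X h DF \<gamma> y1 w n = smd_dual X h G \<gamma> y1 w n" for n
      by (rule smd_dual_cong) (use elim(1) in \<open>simp add: G_def\<close>)
    then show ?case using elim(2) by (simp add: smd_def[abs_def])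
  qed
  interpret N: prob_space N
    using \<open>iid_samples N M W\<close> by (simp add: iid_samples_def)
  have W: "N.indep_vars (\<lambda>_. M) W UNIV" "\<And>n. distr N M (W n) = M"
    using \<open>iid_samples N M W\<close> by (auto simp: iid_samples_def)
  have W_meas: "W n \<in> measurable N M" for n
    using W(1) by (auto simp: N.indep_vars_def)
  \<comment> \<open>For independent samples with common law \<open>M\<close>, the joint law is the
    product measure, so the almost sure statement can be pulled back to \<open>N\<close>.\<close>
  have "distr N S (\<lambda>s. \<lambda>i\<in>UNIV. W i s) = S"
    using N.indep_vars_iff_distr_eq_PiM[where I=UNIV and M'="\<lambda>_. M" and X=W] W W_meas by simp
  then have distr: "distr N S (\<lambda>s n. W n s) = S" by (simp add: restrict_def)
  have "AE w in distr N S (\<lambda>s n. W n s). \<exists>q\<in>solutions. smd X h DF \<gamma> y1 w \<longlonglongrightarrow> q"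
    unfolding distr by (rule conv)
  then show ?thesis
    by (rule AE_distrD[rotated])
       (use W_meas in \<open>auto intro!: measurable_PiM_single' dest: measurable_space\<close>)
qed

end
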